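(* Let $n\geq 4$, and let $W$ be the Coxeter group of type $D_n$ with Vogan representation $\phi$. Then $\phi$ is faithful when $n$ is odd, and $\mathrm{Ker}\,\phi$ has order $2$ when $n$ is even. Moreover, $\mathrm{Ker}\,\phi$ is the center $Z(W)$ of $W$.
   Context: The Coxeter graph of type $D_n$ has vertex set $S=\{s_1,\dots,s_n\}$ and edge set $R=\{s_is_{i+1}: 1\le i\le n-2\}\cup\{s_{n-2}s_n\}$. The Coxeter group $W$ of type $D_n$ is generated by $S$ with relations $s^2=1$, $(ss')^3=1$ if $ss'\in R$, and $(ss')^2=1$ if $s\ne s'$, $ss'\notin R$. $F_2^n$ is the space of column vectors over the two-element field $F_2$ indexed by $S$, and $\widetilde{s}$ is the characteristic vector of $s\in S$. For $s\in S$, $\mathbf{s}$ is the $n\times n$ matrix over $F_2$ acting by $\mathbf{s}\widetilde{v}=\widetilde{v}$ for $v\ne s$ and $\mathbf{s}\widetilde{s}=\widetilde{s}+\sum_{us\in R}\widetilde{u}$. The Vogan representation of $W$ is the homomorphism $\phi:W\to\mathrm{GL}_n(F_2)$ with $\phi(s)=\mathbf{s}$ for $s\in S$. Faithful means injective. *)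

theory Defs
  imports "HOL-Algebra.Coset" "HOL-Library.Z2" "Jordan_Normal_Form.Matrix"
begin

section \<open>Groups given by generators and relations\<close>

text \<open>A letter \<open>(s, True)\<close> stands for the generator \<open>s\<close>, and \<open>(s, False)\<close> for its formal inverse.
  The relators are words that are set equal to 1.\<close>

type_synonym 'a sword = "('a \<times> bool) list"

definition swords :: "'a set \<Rightarrow> 'a sword set"
  where "swords S = lists (S \<times> UNIV)"

inductive pres_eq :: "'a set \<Rightarrow> 'a sword set \<Rightarrow> 'a sword \<Rightarrow> 'a sword \<Rightarrow> bool"
  for S :: "'a set" and Q :: "'a sword set" where
  refl: "w \<in> swords S \<Longrightarrow> pres_eq S Q w w"
| sym: "pres_eq S Q v w \<Longrightarrow> pres_eq S Q w v"
| trans: "pres_eq S Q u v \<Longrightarrow> pres_eq S Q v w \<Longrightarrow> pres_eq S Q u w"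
| cancel: "u \<in> swords S \<Longrightarrow> v \<in> swords S \<Longrightarrow> s \<in> S \<Longrightarrow> pres_eq S Q (u @ [(s, b), (s, \<not> b)] @ v) (u @ v)"
| relator: "u \<in> swords S \<Longrightarrow> v \<in> swords S \<Longrightarrow> r \<in> Q \<Longrightarrow> r \<in> swords S \<Longrightarrow> pres_eq S Q (u @ r @ v) (u @ v)"

definition pres_rel :: "'a set \<Rightarrow> 'a sword set \<Rightarrow> 'a sword rel"
  where "pres_rel S Q = {(v, w). pres_eq S Q v w}"

definition pres_class :: "'a set \<Rightarrow> 'a sword set \<Rightarrow> 'a sword \<Rightarrow> 'a sword set"
  where "pres_class S Q w = pres_rel S Q `` {w}"

definition presented_group :: "'a set \<Rightarrow> 'a sword set \<Rightarrow> 'a sword set monoid"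
  where "presented_group S Q =
    \<lparr>carrier = swords S // pres_rel S Q,
     monoid.mult = (\<lambda>A B. \<Union>v\<in>A. \<Union>w\<in>B. pres_class S Q (v @ w)),
     one = pres_class S Q []\<rparr>"

definition group_center :: "('a, 'b) monoid_scheme \<Rightarrow> 'a set"
  where "group_center G = {z \<in> carrier G. \<forall>g \<in> carrier G. z \<otimes>\<^bsub>G\<^esub> g = g \<otimes>\<^bsub>G\<^esub> z}"


section \<open>Simply laced Coxeter groups and type D\<close>

definition gen_pow :: "'a \<Rightarrow> 'a \<Rightarrow> nat \<Rightarrow> 'a sword"
  where "gen_pow s t k = concat (replicate k [(s, True), (t, True)])"

definition coxeter_relators :: "'a set \<Rightarrow> 'a set set \<Rightarrow> 'a sword set"
  where "coxeter_relators S R =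
    {[(s, True), (s, True)] | s. s \<in> S} \<union>
    {gen_pow s t 3 | s t. s \<in> S \<and> t \<in> S \<and> {s, t} \<in> R} \<union>
    {gen_pow s t 2 | s t. s \<in> S \<and> t \<in> S \<and> s \<noteq> t \<and> {s, t} \<notin> R}"

definition coxeter_group :: "'a set \<Rightarrow> 'a set set \<Rightarrow> 'a sword set monoid"
  where "coxeter_group S R = presented_group S (coxeter_relators S R)"

definition coxeter_gen :: "'a set \<Rightarrow> 'a set set \<Rightarrow> 'a \<Rightarrow> 'a sword set"
  where "coxeter_gen S R s = pres_class S (coxeter_relators S R) [(s, True)]"

text \<open>The vertex \<open>s\<^sub>i\<close> is represented by its index \<open>i\<close>.\<close>

definition D_vertices :: "nat \<Rightarrow> nat set"
  where "D_vertices n = {1..n}"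

definition D_edges :: "nat \<Rightarrow> nat set set"
  where "D_edges n = {{i, i + 1} | i. 1 \<le> i \<and> i \<le> n - 2} \<union> {{n - 2, n}}"

abbreviation D_group :: "nat \<Rightarrow> nat sword set monoid"
  where "D_group n \<equiv> coxeter_group (D_vertices n) (D_edges n)"

abbreviation D_gen :: "nat \<Rightarrow> nat \<Rightarrow> nat sword set"
  where "D_gen n \<equiv> coxeter_gen (D_vertices n) (D_edges n)"


section \<open>The Vogan representation\<close>

definition GL_F2 :: "nat \<Rightarrow> bit mat monoid"
  where "GL_F2 n = units_of (ring_mat TYPE(bit) n ())"

text \<open>Matrix and vector indices are zero-based, so the vertex \<open>s\<close> has the coordinate \<open>s - 1\<close>.\<close>

definition char_vec :: "nat \<Rightarrow> nat \<Rightarrow> bit vec"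
  where "char_vec n s = unit_vec n (s - 1)"

definition vogan_matrix :: "nat \<Rightarrow> nat set set \<Rightarrow> nat \<Rightarrow> bit mat"
  where "vogan_matrix n R s = mat_of_cols n
    (map (\<lambda>v. if v = s
              then char_vec n s + finsum_vec TYPE(bit) n (char_vec n) {u \<in> {1..n}. {u, s} \<in> R}
              else char_vec n v) [1..<n + 1])"

definition vogan_representation :: "nat \<Rightarrow> (nat sword set \<Rightarrow> bit mat) \<Rightarrow> bool"
  where "vogan_representation n \<phi> \<longleftrightarrow>
    \<phi> \<in> hom (D_group n) (GL_F2 n) \<and>
    (\<forall>s \<in> D_vertices n. \<phi> (D_gen n s) = vogan_matrix n (D_edges n) s)"


section \<open>Presented groups are groups with the expected universal property\<close>

lemma swords_append [simp]: "u @ v \<in> swords S \<longleftrightarrow> u \<in> swords S \<and> v \<in> swords S"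
  by (auto simp: swords_def)

lemma swords_Nil [simp]: "[] \<in> swords S"
  by (auto simp: swords_def)

lemma swords_Cons [simp]: "(s, b) # v \<in> swords S \<longleftrightarrow> s \<in> S \<and> v \<in> swords S"
  by (auto simp: swords_def)

lemma pres_eq_swords: "pres_eq S Q v w \<Longrightarrow> v \<in> swords S \<and> w \<in> swords S"
  by (induction rule: pres_eq.induct) auto

lemma equiv_pres_rel: "equiv (swords S) (pres_rel S Q)"
proof (rule equivI)
  show "pres_rel S Q \<subseteq> swords S \<times> swords S"
    using pres_eq_swords[of S Q] by (auto simp: pres_rel_def)
qed (auto simp: refl_on_def sym_def trans_def pres_rel_def
      intro: pres_eq.refl pres_eq.sym pres_eq.trans)

lemma pres_class_eq_iff:
  "v \<in> swords S \<Longrightarrow> w \<in> swords S \<Longrightarrow> pres_class S Q v = pres_class S Q w \<longleftrightarrow> pres_eq S Q v w"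
  using eq_equiv_class_iff[OF equiv_pres_rel[of S Q], of v w]
  by (auto simp: pres_class_def pres_rel_def)

lemma pres_eq_append_left: "pres_eq S Q v w \<Longrightarrow> x \<in> swords S \<Longrightarrow> pres_eq S Q (x @ v) (x @ w)"
proof (induction rule: pres_eq.induct)
  case (cancel u v s b)
  then show ?case using pres_eq.cancel[of "x @ u" S v s Q b] by simp
next
  case (relator u v r)
  then show ?case using pres_eq.relator[of "x @ u" S v r Q] by simp
qed (auto intro: pres_eq.intros)

lemma pres_eq_append_right: "pres_eq S Q v w \<Longrightarrow> x \<in> swords S \<Longrightarrow> pres_eq S Q (v @ x) (w @ x)"
proof (induction rule: pres_eq.induct)
  case (cancel u v s b)
  then show ?case using pres_eq.cancel[of u S "v @ x" s Q b] by simp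
next
  case (relator u v r)
  then show ?case using pres_eq.relator[of u S "v @ x" r Q] by simp
qed (auto intro: pres_eq.intros)

lemma pres_eq_append:
  assumes "pres_eq S Q v v'" "pres_eq S Q w w'"
  shows "pres_eq S Q (v @ w) (v' @ w')"
proof (rule pres_eq.trans)
  show "pres_eq S Q (v @ w) (v' @ w)"
    using assms pres_eq_swords[OF assms(2)] by (intro pres_eq_append_right) auto
  show "pres_eq S Q (v' @ w) (v' @ w')"
    using assms pres_eq_swords[OF assms(1)] by (intro pres_eq_append_left) auto
qed

lemma carrier_presented_group:
  "carrier (presented_group S Q) = pres_class S Q ` swords S"
  by (auto simp: presented_group_def quotient_def pres_class_def)

lemma one_presented_group: "\<one>\<^bsub>presented_group S Q\<^esub> = pres_class S Q []"
  by (simp add: presented_group_def)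

lemma mult_presented_group:
  assumes "v \<in> swords S" "w \<in> swords S"
  shows "pres_class S Q v \<otimes>\<^bsub>presented_group S Q\<^esub> pres_class S Q w = pres_class S Q (v @ w)"
proof -
  have self: "v \<in> pres_class S Q v" "w \<in> pres_class S Q w"
    using assms by (auto simp: pres_class_def pres_rel_def intro: pres_eq.refl)
  have "pres_class S Q (v' @ w') = pres_class S Q (v @ w)"
    if "v' \<in> pres_class S Q v" "w' \<in> pres_class S Q w" for v' w'
  proof -
    have "pres_eq S Q v v'" "pres_eq S Q w w'"
      using that by (auto simp: pres_class_def pres_rel_def)
    then have "pres_eq S Q (v @ w) (v' @ w')" by (rule pres_eq_append)
    then show ?thesis
      unfolding pres_class_def
      by (intro equiv_class_eq[OF equiv_pres_rel, symmetric]) (simp add: pres_rel_def)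
  qed
  then have "(\<Union>v'\<in>pres_class S Q v. \<Union>w'\<in>pres_class S Q w. pres_class S Q (v' @ w'))
      = pres_class S Q (v @ w)"
    using self by blast
  then show ?thesis by (simp add: presented_group_def)
qed

definition inv_word :: "'a sword \<Rightarrow> 'a sword"
  where "inv_word w = rev (map (\<lambda>(s, b). (s, \<not> b)) w)"

lemma inv_word_swords: "w \<in> swords S \<Longrightarrow> inv_word w \<in> swords S"
  by (induction w) (auto simp: inv_word_def)

lemma inv_word_cancel: "w \<in> swords S \<Longrightarrow> pres_eq S Q (inv_word w @ w) []"
proof (induction w)
  case Nil
  then show ?case by (simp add: inv_word_def pres_eq.refl)
next
  case (Cons a w)
  obtain s b where a: "a = (s, b)" by (cases a)
  have sw: "s \<in> S" "w \<in> swords S" using Cons.prems a by auto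
  have "pres_eq S Q (inv_word w @ [(s, \<not> b), (s, \<not> \<not> b)] @ w) (inv_word w @ w)"
    using pres_eq.cancel[OF inv_word_swords[OF sw(2)] sw(2) sw(1)] .
  then show ?case using Cons.IH[OF sw(2)] a pres_eq.trans by (fastforce simp: inv_word_def)
qed

lemma group_presented_group: "group (presented_group S Q)"
proof (rule groupI)
  let ?P = "presented_group S Q"
  let ?c = "pres_class S Q"
  have rep: "\<exists>w\<in>swords S. x = ?c w" if "x \<in> carrier ?P" for x
    using that unfolding carrier_presented_group by blast
  have closed: "?c w \<in> carrier ?P" if "w \<in> swords S" for w
    using that unfolding carrier_presented_group by (rule imageI)
  show "\<one>\<^bsub>?P\<^esub> \<in> carrier ?P"
    unfolding one_presented_group by (rule closed) simp
  fix x assume "x \<in> carrier ?P"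
  then obtain u where u: "u \<in> swords S" "x = ?c u" using rep by blast
  show "\<one>\<^bsub>?P\<^esub> \<otimes>\<^bsub>?P\<^esub> x = x"
    using u by (simp add: one_presented_group mult_presented_group)
  have "?c (inv_word u) \<otimes>\<^bsub>?P\<^esub> x = \<one>\<^bsub>?P\<^esub>"
    using u inv_word_swords[OF u(1)] inv_word_cancel[OF u(1), of Q]
    by (simp add: mult_presented_group one_presented_group pres_class_eq_iff)
  then show "\<exists>y\<in>carrier ?P. y \<otimes>\<^bsub>?P\<^esub> x = \<one>\<^bsub>?P\<^esub>"
    using closed[OF inv_word_swords[OF u(1)]] by blast
  fix y assume "y \<in> carrier ?P"
  then obtain v where v: "v \<in> swords S" "y = ?c v" using rep by blast
  show "x \<otimes>\<^bsub>?P\<^esub> y \<in> carrier ?P"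
    using u v closed[of "u @ v"] by (simp add: mult_presented_group)
  fix z assume "z \<in> carrier ?P"
  then obtain w where w: "w \<in> swords S" "z = ?c w" using rep by blast
  show "x \<otimes>\<^bsub>?P\<^esub> y \<otimes>\<^bsub>?P\<^esub> z = x \<otimes>\<^bsub>?P\<^esub> (y \<otimes>\<^bsub>?P\<^esub> z)"
    using u v w by (simp add: mult_presented_group)
qed

fun eval_word :: "('b, 'c) monoid_scheme \<Rightarrow> ('a \<Rightarrow> 'b) \<Rightarrow> 'a sword \<Rightarrow> 'b" where
  "eval_word H f [] = \<one>\<^bsub>H\<^esub>"
| "eval_word H f ((s, b) # w) = (if b then f s else inv\<^bsub>H\<^esub> f s) \<otimes>\<^bsub>H\<^esub> eval_word H f w"

context group
begin

lemma eval_word_closed: "\<forall>s\<in>S. f s \<in> carrier G \<Longrightarrow> w \<in> swords S \<Longrightarrow> eval_word G f w \<in> carrier G"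
  by (induction w) auto

lemma eval_word_append:
  "\<forall>s\<in>S. f s \<in> carrier G \<Longrightarrow> v \<in> swords S \<Longrightarrow> w \<in> swords S \<Longrightarrow>
    eval_word G f (v @ w) = eval_word G f v \<otimes> eval_word G f w"
proof (induction v)
  case Nil
  then show ?case using eval_word_closed by force
next
  case (Cons a v)
  obtain s b where a: "a = (s, b)" by (cases a)
  have c: "f s \<in> carrier G" "eval_word G f v \<in> carrier G" "eval_word G f w \<in> carrier G"
    using Cons.prems a eval_word_closed[of S f] by auto
  show ?case using Cons a c by (auto simp: m_assoc)
qed

lemma eval_word_pres_eq:
  assumes f: "\<forall>s\<in>S. f s \<in> carrier G" and Q: "\<And>r. r \<in> Q \<Longrightarrow> eval_word G f r = \<one>"
    and e: "pres_eq S Q v w"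
  shows "eval_word G f v = eval_word G f w"
  using e
proof (induction rule: pres_eq.induct)
  case (cancel u v s b)
  have c: "f s \<in> carrier G" "eval_word G f u \<in> carrier G" "eval_word G f v \<in> carrier G"
    using cancel f eval_word_closed[OF f] by auto
  have "eval_word G f [(s, b), (s, \<not> b)] = \<one>"
    using c by auto
  moreover have "[(s, b), (s, \<not> b)] \<in> swords S"
    using cancel by simp
  ultimately show ?case
    using cancel c by (simp only: eval_word_append[OF f] swords_append l_one)
next
  case (relator u v r)
  then show ?case
    using Q eval_word_closed[OF f] by (simp add: eval_word_append[OF f])
qed auto

lemma presented_group_universal:
  assumes f: "\<forall>s\<in>S. f s \<in> carrier G" and Q: "\<And>r. r \<in> Q \<Longrightarrow> eval_word G f r = \<one>"
  shows "\<exists>h \<in> hom (presented_group S Q) G. \<forall>s\<in>S. h (pres_class S Q [(s, True)]) = f s"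
proof -
  define h where "h A = eval_word G f (SOME w. w \<in> A)" for A
  have h: "h (pres_class S Q w) = eval_word G f w" if w: "w \<in> swords S" for w
  proof -
    have "w \<in> pres_class S Q w"
      using w by (auto simp: pres_class_def pres_rel_def intro: pres_eq.refl)
    then have "(SOME v. v \<in> pres_class S Q w) \<in> pres_class S Q w" by (rule someI)
    then have "pres_eq S Q w (SOME v. v \<in> pres_class S Q w)"
      by (simp add: pres_class_def pres_rel_def)
    then show ?thesis using eval_word_pres_eq[OF f Q] by (simp add: h_def)
  qed
  have "h \<in> hom (presented_group S Q) G"
    using eval_word_closed[OF f] eval_word_append[OF f]
    by (auto simp: hom_def carrier_presented_group mult_presented_group h)
  moreover have "\<forall>s\<in>S. h (pres_class S Q [(s, True)]) = f s"
    using f by (auto simp: h)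
  ultimately show ?thesis by blast
qed

lemma hom_presented_group_eq:
  assumes h: "h \<in> hom (presented_group S Q) G"
    and f: "\<forall>s\<in>S. f s \<in> carrier G" and gen: "\<forall>s\<in>S. h (pres_class S Q [(s, True)]) = f s"
    and w: "w \<in> swords S"
  shows "h (pres_class S Q w) = eval_word G f w"
  using w
proof (induction w)
  case Nil
  interpret P: group "presented_group S Q" by (rule group_presented_group)
  show ?case using hom_one[OF h P.is_group is_group] by (simp add: one_presented_group)
next
  case (Cons a w)
  interpret P: group "presented_group S Q" by (rule group_presented_group)
  interpret hom: group_hom "presented_group S Q" G h
    by unfold_locales (rule h)
  obtain s b where a: "a = (s, b)" by (cases a)
  have sw: "s \<in> S" "w \<in> swords S" using Cons.prems a by auto
  let ?c = "pres_class S Q"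
  have pos: "?c [(s, True)] \<in> carrier (presented_group S Q)"
    and neg: "?c [(s, False)] \<in> carrier (presented_group S Q)"
    and cw: "?c w \<in> carrier (presented_group S Q)"
    using sw by (auto simp: carrier_presented_group)
  have "?c [(s, False)] \<otimes>\<^bsub>presented_group S Q\<^esub> ?c [(s, True)] = \<one>\<^bsub>presented_group S Q\<^esub>"
    using sw pres_eq.cancel[of "[]" S "[]" s Q False]
    by (simp add: mult_presented_group one_presented_group pres_class_eq_iff)
  then have "?c [(s, False)] = inv\<^bsub>presented_group S Q\<^esub> ?c [(s, True)]"
    using pos neg P.inv_equality by metis
  then have "h (?c [(s, b)]) = (if b then f s else inv f s)"
    using gen sw pos by (cases b) auto
  moreover have "?c (a # w) = ?c [(s, b)] \<otimes>\<^bsub>presented_group S Q\<^esub> ?c w"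
    using sw a by (simp add: mult_presented_group)
  ultimately show ?case using Cons.IH[OF sw(2)] pos neg cw a by (cases b) auto
qed

end


section \<open>The Vogan representation exists and is unique\<close>

lemma vogan_matrix_carrier [simp]: "vogan_matrix n R s \<in> carrier_mat n n"
  by (auto simp: vogan_matrix_def mat_of_cols_def)

lemma index_vogan_matrix:
  assumes "u < n" "v < n"
  shows "vogan_matrix n R s $$ (u, v) =
    of_bool (u = v) + of_bool (Suc v = s) * of_bool ({Suc u, s} \<in> R)"
proof -
  let ?N = "{w \<in> {1..n}. {w, s} \<in> R}"
  have nbr: "finsum_vec TYPE(bit) n (char_vec n) ?N $ u = of_bool ({Suc u, s} \<in> R)"
  proof -
    have "finsum_vec TYPE(bit) n (char_vec n) ?N $ u = (\<Sum>w\<in>?N. char_vec n w $ u)"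
      using assms by (intro index_finsum_vec) (auto simp: char_vec_def)
    also have "\<dots> = (\<Sum>w\<in>?N. if w = Suc u then 1 else 0)"
      using assms by (intro sum.cong) (auto simp: char_vec_def)
    also have "\<dots> = of_bool ({Suc u, s} \<in> R)"
      using assms by (subst sum.delta) auto
    finally show ?thesis .
  qed
  have dim: "dim_vec (finsum_vec TYPE(bit) n (char_vec n) ?N) = n"
    using finsum_vec_closed[of "char_vec n" ?N n] by (auto simp: char_vec_def)
  have "[1..<n + 1] ! v = Suc v"
    using assms by (simp del: upt_Suc)
  then show ?thesis
    using assms nbr dim by (auto simp: vogan_matrix_def mat_of_cols_index char_vec_def simp del: upt_Suc)
qed

lemma vogan_matrix_char_vec:
  assumes "v \<in> {1..n}"
  shows "vogan_matrix n R s *\<^sub>v char_vec n v =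
    (if v = s then char_vec n s + finsum_vec TYPE(bit) n (char_vec n) {u \<in> {1..n}. {u, s} \<in> R}
     else char_vec n v)"
proof -
  have c: "finsum_vec TYPE(bit) n (char_vec n) {u \<in> {1..n}. {u, s} \<in> R} \<in> carrier_vec n"
    by (rule finsum_vec_closed) (auto simp: char_vec_def)
  have "vogan_matrix n R s *\<^sub>v char_vec n v = col (vogan_matrix n R s) (v - 1)"
    using assms by (intro eq_vecI) (auto simp: char_vec_def carrier_matD[OF vogan_matrix_carrier])
  also have "\<dots> = map (\<lambda>v. if v = s
              then char_vec n s + finsum_vec TYPE(bit) n (char_vec n) {u \<in> {1..n}. {u, s} \<in> R}
              else char_vec n v) [1..<n + 1] ! (v - 1)"
    unfolding vogan_matrix_def using assms c
    by (intro col_mat_of_cols) (auto simp: char_vec_def simp del: upt_Suc)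
  also have "\<dots> = (if v = s
      then char_vec n s + finsum_vec TYPE(bit) n (char_vec n) {u \<in> {1..n}. {u, s} \<in> R}
      else char_vec n v)"
  proof -
    have "v - 1 < length [1..<n + 1]" "[1..<n + 1] ! (v - 1) = v"
      using assms by (auto simp del: upt_Suc)
    then show ?thesis by (simp only: nth_map)
  qed
  finally show ?thesis .
qed

lemma vogan_matrix_mult_vec:
  assumes "x \<in> carrier_vec n" "s \<in> {1..n}" "u < n"
  shows "(vogan_matrix n R s *\<^sub>v x) $ u = x $ u + x $ (s - 1) * of_bool ({Suc u, s} \<in> R)"
proof -
  have "(vogan_matrix n R s *\<^sub>v x) $ u = (\<Sum>k\<in>{0..<n}. vogan_matrix n R s $$ (u, k) * x $ k)"
    using assms by (auto simp: scalar_prod_def carrier_matD[OF vogan_matrix_carrier])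
  also have "\<dots> = (\<Sum>k\<in>{0..<n}. (if k = u then x $ k else 0) +
      (if k = s - 1 then x $ k * of_bool ({Suc u, s} \<in> R) else 0))"
    using assms by (intro sum.cong) (auto simp: index_vogan_matrix)
  also have "\<dots> = x $ u + x $ (s - 1) * of_bool ({Suc u, s} \<in> R)"
    using assms by (subst sum.distrib, subst (1 2) sum.delta) auto
  finally show ?thesis .
qed

lemma bit_mat_eqI:
  fixes A B :: "bit mat"
  assumes "A \<in> carrier_mat n n" "B \<in> carrier_mat n n"
    and "\<And>x. x \<in> carrier_vec n \<Longrightarrow> A *\<^sub>v x = B *\<^sub>v x"
  shows "A = B"
proof (rule eq_matI)
  fix i j assume ij: "i < dim_row B" "j < dim_col B"
  have "(A *\<^sub>v unit_vec n j) $ i = (B *\<^sub>v unit_vec n j) $ i"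
    using assms(3)[of "unit_vec n j"] by simp
  then show "A $$ (i, j) = B $$ (i, j)"
    using assms(1,2) ij by auto
qed (use assms in auto)

lemma vogan_matrix_mult_vec_carrier [simp]:
  "x \<in> carrier_vec n \<Longrightarrow> vogan_matrix n R s *\<^sub>v x \<in> carrier_vec n"
  by (rule mult_mat_vec_carrier[OF vogan_matrix_carrier])

lemma vogan_matrix_square:
  assumes "s \<in> {1..n}" "{s} \<notin> R"
  shows "vogan_matrix n R s * vogan_matrix n R s = 1\<^sub>m n"
proof (rule bit_mat_eqI)
  fix x :: "bit vec" assume x: "x \<in> carrier_vec n"
  obtain i where i: "s = Suc i" "i < n" using assms(1) by (cases s) auto
  have "vogan_matrix n R s *\<^sub>v (vogan_matrix n R s *\<^sub>v x) = x"
    using assms x i by (intro eq_vecI) (auto simp: vogan_matrix_mult_vec carrier_vecD[OF x]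
        carrier_matD[OF vogan_matrix_carrier]
        insert_commute simp del: index_mult_mat_vec)
  then show "vogan_matrix n R s * vogan_matrix n R s *\<^sub>v x = 1\<^sub>m n *\<^sub>v x"
    using x by (simp add: assoc_mult_mat_vec[OF vogan_matrix_carrier vogan_matrix_carrier])
qed (auto intro: mult_carrier_mat[OF vogan_matrix_carrier vogan_matrix_carrier])

lemma vogan_matrix_braid:
  assumes "s \<in> {1..n}" "t \<in> {1..n}" "{s} \<notin> R" "{t} \<notin> R" "{s, t} \<in> R"
  shows "vogan_matrix n R s * vogan_matrix n R t * vogan_matrix n R s =
    vogan_matrix n R t * vogan_matrix n R s * vogan_matrix n R t"
    (is "?A * ?B * ?A = ?B * ?A * ?B")
proof (rule bit_mat_eqI)
  fix x :: "bit vec" assume x: "x \<in> carrier_vec n"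
  have st: "{t, s} \<in> R" using assms(5) by (simp add: insert_commute)
  obtain i where i: "s = Suc i" "i < n" using assms(1) by (cases s) auto
  obtain j where j: "t = Suc j" "j < n" using assms(2) by (cases t) auto
  have "?A *\<^sub>v (?B *\<^sub>v (?A *\<^sub>v x)) = ?B *\<^sub>v (?A *\<^sub>v (?B *\<^sub>v x))"
    using assms st x i j
    by (intro eq_vecI) (auto simp: vogan_matrix_mult_vec carrier_vecD[OF x]
        carrier_matD[OF vogan_matrix_carrier]
        insert_commute simp del: index_mult_mat_vec)
  then show "?A * ?B * ?A *\<^sub>v x = ?B * ?A * ?B *\<^sub>v x"
    using x by (simp add: assoc_mult_mat_vec[OF vogan_matrix_carrier vogan_matrix_carrier]
        assoc_mult_mat_vec[OF mult_carrier_mat[OF vogan_matrix_carrier vogan_matrix_carrier]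
          vogan_matrix_carrier])
qed (auto intro!: mult_carrier_mat[OF _ vogan_matrix_carrier])

lemma vogan_matrix_commute:
  assumes "s \<in> {1..n}" "t \<in> {1..n}" "{s, t} \<notin> R"
  shows "vogan_matrix n R s * vogan_matrix n R t = vogan_matrix n R t * vogan_matrix n R s"
    (is "?A * ?B = ?B * ?A")
proof (rule bit_mat_eqI)
  fix x :: "bit vec" assume x: "x \<in> carrier_vec n"
  have st: "{t, s} \<notin> R" using assms(3) by (simp add: insert_commute)
  obtain i where i: "s = Suc i" "i < n" using assms(1) by (cases s) auto
  obtain j where j: "t = Suc j" "j < n" using assms(2) by (cases t) auto
  have "?A *\<^sub>v (?B *\<^sub>v x) = ?B *\<^sub>v (?A *\<^sub>v x)"
    using assms st x i j
    by (intro eq_vecI) (auto simp: vogan_matrix_mult_vec carrier_vecD[OF x]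
        carrier_matD[OF vogan_matrix_carrier]
        insert_commute simp del: index_mult_mat_vec)
  then show "?A * ?B *\<^sub>v x = ?B * ?A *\<^sub>v x"
    using x by (simp add: assoc_mult_mat_vec[OF vogan_matrix_carrier vogan_matrix_carrier])
qed (auto intro!: mult_carrier_mat[OF _ vogan_matrix_carrier])

lemma group_GL_F2: "group (GL_F2 n)"
proof -
  interpret ring "ring_mat TYPE(bit) n ()" by (rule ring_mat)
  show ?thesis unfolding GL_F2_def by (rule units_group)
qed

lemma GL_F2_simps:
  "A \<otimes>\<^bsub>GL_F2 n\<^esub> B = A * B" "\<one>\<^bsub>GL_F2 n\<^esub> = 1\<^sub>m n"
  by (simp_all add: GL_F2_def units_of_def ring_mat_simps)

lemma vogan_matrix_GL_F2:
  assumes "s \<in> {1..n}" "{s} \<notin> R"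
  shows "vogan_matrix n R s \<in> carrier (GL_F2 n)"
  using vogan_matrix_square[OF assms]
  by (auto simp: GL_F2_def units_of_def ring_mat_simps Units_def
      intro!: bexI[of _ "vogan_matrix n R s"])

lemma (in group) eval_word_gen_pow_2:
  assumes "f s \<in> carrier G" "f t \<in> carrier G" "f s \<otimes> f s = \<one>" "f t \<otimes> f t = \<one>"
    and "f s \<otimes> f t = f t \<otimes> f s"
  shows "eval_word G f (gen_pow s t 2) = \<one>"
proof -
  have "eval_word G f (gen_pow s t 2) = f s \<otimes> f t \<otimes> (f s \<otimes> f t)"
    using assms(1,2) by (simp add: gen_pow_def numeral_2_eq_2 m_assoc)
  also have "\<dots> = f s \<otimes> f t \<otimes> (f t \<otimes> f s)" by (simp only: assms(5))
  also have "\<dots> = f s \<otimes> (f t \<otimes> f t) \<otimes> f s" using assms(1,2) by (simp add: m_assoc)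
  also have "\<dots> = \<one>" using assms by simp
  finally show ?thesis .
qed

lemma (in group) eval_word_gen_pow_3:
  assumes "f s \<in> carrier G" "f t \<in> carrier G" "f s \<otimes> f s = \<one>" "f t \<otimes> f t = \<one>"
    and "f s \<otimes> f t \<otimes> f s = f t \<otimes> f s \<otimes> f t"
  shows "eval_word G f (gen_pow s t 3) = \<one>"
proof -
  have "eval_word G f (gen_pow s t 3) = f s \<otimes> f t \<otimes> f s \<otimes> (f t \<otimes> f s \<otimes> f t)"
    using assms(1,2) by (simp add: gen_pow_def numeral_3_eq_3 m_assoc)
  also have "\<dots> = f s \<otimes> f t \<otimes> f s \<otimes> (f s \<otimes> f t \<otimes> f s)" by (simp only: assms(5))
  also have "\<dots> = f s \<otimes> (f t \<otimes> (f s \<otimes> f s) \<otimes> f t) \<otimes> f s"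
    using assms(1,2) by (simp add: m_assoc)
  also have "\<dots> = \<one>" using assms by simp
  finally show ?thesis .
qed

lemma D_edges_no_loop:
  assumes "n \<ge> 4"
  shows "{s} \<notin> D_edges n"
proof
  assume "{s} \<in> D_edges n"
  then consider i where "{s} = {i, i + 1}" | "{s} = {n - 2, n}"
    by (auto simp: D_edges_def)
  then show False
  proof cases
    case 1
    then have "i = s" "i + 1 = s" by blast+
    then show False by simp
  next
    case 2
    then have "n - 2 = s" "n = s" by blast+
    then show False using assms by simp
  qed
qed

lemma vogan_representation_exists:
  assumes "n \<ge> 4"
  shows "\<exists>\<phi>. vogan_representation n \<phi>"
proof -
  interpret GL: group "GL_F2 n" by (rule group_GL_F2)
  let ?f = "vogan_matrix n (D_edges n)"
  have f: "\<forall>s\<in>D_vertices n. ?f s \<in> carrier (GL_F2 n)"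
    using vogan_matrix_GL_F2 D_edges_no_loop[OF assms] by (auto simp: D_vertices_def)
  have sq: "?f s \<otimes>\<^bsub>GL_F2 n\<^esub> ?f s = \<one>\<^bsub>GL_F2 n\<^esub>" if "s \<in> D_vertices n" for s
    using that vogan_matrix_square D_edges_no_loop[OF assms] by (auto simp: GL_F2_simps D_vertices_def)
  have "eval_word (GL_F2 n) ?f r = \<one>\<^bsub>GL_F2 n\<^esub>"
    if r: "r \<in> coxeter_relators (D_vertices n) (D_edges n)" for r
  proof -
    consider s where "s \<in> D_vertices n" "r = [(s, True), (s, True)]"
      | s t where "s \<in> D_vertices n" "t \<in> D_vertices n" "{s, t} \<in> D_edges n" "r = gen_pow s t 3"
      | s t where "s \<in> D_vertices n" "t \<in> D_vertices n" "{s, t} \<notin> D_edges n" "r = gen_pow s t 2"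
      using r by (auto simp: coxeter_relators_def)
    then show ?thesis
    proof cases
      case 1
      then have "?f s \<in> carrier (GL_F2 n)" using f by auto
      then show ?thesis using 1 sq by simp
    next
      case 2
      have "?f s \<otimes>\<^bsub>GL_F2 n\<^esub> ?f t \<otimes>\<^bsub>GL_F2 n\<^esub> ?f s = ?f t \<otimes>\<^bsub>GL_F2 n\<^esub> ?f s \<otimes>\<^bsub>GL_F2 n\<^esub> ?f t"
        using 2 D_edges_no_loop[OF assms] unfolding GL_F2_simps D_vertices_def
        by (intro vogan_matrix_braid)
      then show ?thesis
        using 2 f sq GL.eval_word_gen_pow_3[of ?f s t] by auto
    next
      case 3
      have "?f s \<otimes>\<^bsub>GL_F2 n\<^esub> ?f t = ?f t \<otimes>\<^bsub>GL_F2 n\<^esub> ?f s"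
        using 3 unfolding GL_F2_simps D_vertices_def by (intro vogan_matrix_commute)
      then show ?thesis
        using 3 f sq GL.eval_word_gen_pow_2[of ?f s t] by auto
    qed
  qed
  from GL.presented_group_universal[OF f this]
  show ?thesis by (auto simp: vogan_representation_def coxeter_group_def coxeter_gen_def)
qed

lemma vogan_representation_unique:
  assumes "n \<ge> 4" "vogan_representation n \<phi>" "vogan_representation n \<psi>"
    and "g \<in> carrier (D_group n)"
  shows "\<phi> g = \<psi> g"
proof -
  interpret GL: group "GL_F2 n" by (rule group_GL_F2)
  let ?f = "vogan_matrix n (D_edges n)"
  have f: "\<forall>s\<in>D_vertices n. ?f s \<in> carrier (GL_F2 n)"
    using vogan_matrix_GL_F2 D_edges_no_loop[OF assms(1)] by (auto simp: D_vertices_def)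
  obtain w where w: "w \<in> swords (D_vertices n)"
    "g = pres_class (D_vertices n) (coxeter_relators (D_vertices n) (D_edges n)) w"
    using assms(4) by (auto simp: coxeter_group_def carrier_presented_group)
  have "\<rho> g = eval_word (GL_F2 n) ?f w" if "vogan_representation n \<rho>" for \<rho>
    unfolding w(2)
    using that by (intro GL.hom_presented_group_eq f w(1))
      (auto simp: vogan_representation_def coxeter_group_def coxeter_gen_def)
  from this[OF assms(2)] this[OF assms(3)] show ?thesis by simp
qed

end

theory Submission
  imports Defs
begin

text \<open>The group of type D acts faithfully by permutations and even sign changes of \<open>n\<close> coordinates.
  Faithfulness on the presented group follows by descending along the parabolic subgroups on the
  vertices \<open>k, \<dots>, n\<close>: every word is a representative of one of \<open>2 (n - k + 1)\<close> cosets times a word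
  in the vertices above \<open>k\<close>, and the representative is determined by the image of the \<open>k\<close>-th basis
  vector. The Vogan representation is the reduction modulo 2 of the action on the weight lattice. A signed
  permutation that is trivial modulo 2 on the weights \<open>e\<^sub>i\<close> fixes every coordinate up to sign,
  and triviality on the spin weight \<open>(1/2, \<dots>, 1/2)\<close> forces all signs to be equal. Hence the
  kernel consists of the scalars \<open>1\<close> and \<open>-1\<close>, which are also the central elements, and \<open>-1\<close> changes
  an even number of signs only for even \<open>n\<close>.\<close>

section \<open>Words in involutive generators\<close>

text \<open>The group is given only as words modulo relations, so injectivity of the action has to
  be proved by rewriting words. This is done on plain lists of generators modulo
  \<open>cox_cong\<close>, where inverse letters are gone and the relators have become braid and
  commutation moves applicable inside a word.

  The weight lattice, rather than the root lattice, is forced by the shape of the Vogan matrices. A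
  simple reflection \<open>s\<close> sends its own fundamental weight to the negative of it plus the
  fundamental weights of the neighbours of \<open>s\<close>, and fixes the other fundamental
  weights; modulo 2 this is the matrix, with \<open>char_vec n s\<close> as the fundamental weight.
  Simple roots would give the transpose.

  Weights are stored doubled, the integer vector \<open>b\<close> standing for \<open>b / 2\<close>,
  so that spin weights need no fractions. Equality of two weights modulo 2 then forces the entries
  of the doubled difference to be even and congruent to one another modulo 4. Negating an entry 2
  does not disturb this, but moving it does as soon as there are three coordinates.\<close>

inductive cox_cong :: "'a set \<Rightarrow> 'a set set \<Rightarrow> 'a list \<Rightarrow> 'a list \<Rightarrow> bool"
  for S :: "'a set" and R :: "'a set set" where
  refl: "cox_cong S R u u"
| sym: "cox_cong S R u v \<Longrightarrow> cox_cong S R v u"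
| trans: "cox_cong S R u v \<Longrightarrow> cox_cong S R v w \<Longrightarrow> cox_cong S R u w"
| square: "s \<in> S \<Longrightarrow> cox_cong S R (x @ [s, s] @ y) (x @ y)"
| braid: "s \<in> S \<Longrightarrow> t \<in> S \<Longrightarrow> {s, t} \<in> R \<Longrightarrow>
    cox_cong S R (x @ [s, t, s] @ y) (x @ [t, s, t] @ y)"
| commute: "s \<in> S \<Longrightarrow> t \<in> S \<Longrightarrow> s \<noteq> t \<Longrightarrow> {s, t} \<notin> R \<Longrightarrow>
    cox_cong S R (x @ [s, t] @ y) (x @ [t, s] @ y)"

declare cox_cong.trans [trans]

lemma cox_cong_append_left: "cox_cong S R u v \<Longrightarrow> cox_cong S R (x @ u) (x @ v)"
proof (induction rule: cox_cong.induct)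
  case (square s y z)
  then show ?case using cox_cong.square[of s S R "x @ y" z] by simp
next
  case (braid s t y z)
  then show ?case using cox_cong.braid[of s S t R "x @ y" z] by simp
next
  case (commute s t y z)
  then show ?case using cox_cong.commute[of s S t R "x @ y" z] by simp
qed (auto intro: cox_cong.refl cox_cong.sym cox_cong.trans)

lemma cox_cong_append_right: "cox_cong S R u v \<Longrightarrow> cox_cong S R (u @ x) (v @ x)"
proof (induction rule: cox_cong.induct)
  case (square s y z)
  then show ?case using cox_cong.square[of s S R y "z @ x"] by simp
next
  case (braid s t y z)
  then show ?case using cox_cong.braid[of s S t R y "z @ x"] by simp
next
  case (commute s t y z)
  then show ?case using cox_cong.commute[of s S t R y "z @ x"] by simp
qed (auto intro: cox_cong.refl cox_cong.sym cox_cong.trans)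

lemma cox_cong_Cons: "cox_cong S R u v \<Longrightarrow> cox_cong S R (s # u) (s # v)"
  using cox_cong_append_left[of S R u v "[s]"] by simp

lemma cox_cong_Cons_commute:
  assumes "s \<in> S" "\<forall>t\<in>set u. t \<in> S \<and> s \<noteq> t \<and> {s, t} \<notin> R"
  shows "cox_cong S R (s # u) (u @ [s])"
  using assms(2)
proof (induction u)
  case Nil
  then show ?case by (simp add: cox_cong.refl)
next
  case (Cons t u)
  have "cox_cong S R (s # t # u) (t # s # u)"
    using Cons.prems assms(1) cox_cong.commute[of s S t R "[]" u] by auto
  also have "cox_cong S R (t # s # u) (t # u @ [s])"
    using Cons by (intro cox_cong_Cons) auto
  finally show ?case by simp
qed

lemma cox_cong_rev_cancel: "set u \<subseteq> S \<Longrightarrow> cox_cong S R (rev u @ u) []"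
proof (induction u)
  case Nil
  then show ?case by (simp add: cox_cong.refl)
next
  case (Cons s u)
  have "cox_cong S R (rev u @ [s, s] @ u) (rev u @ u)"
    using Cons.prems by (intro cox_cong.square) auto
  also have "cox_cong S R (rev u @ u) []" using Cons by auto
  finally show ?case by simp
qed

lemma cox_cong_set: "cox_cong S R u v \<Longrightarrow> set u \<subseteq> S \<longleftrightarrow> set v \<subseteq> S"
  by (induction rule: cox_cong.induct) auto

abbreviation pos_word :: "'a list \<Rightarrow> 'a sword"
  where "pos_word u \<equiv> map (\<lambda>s. (s, True)) u"

lemma pos_word_swords [simp]: "pos_word u \<in> swords S \<longleftrightarrow> set u \<subseteq> S"
  by (induction u) auto

lemma pres_eq_pos_word_square:
  assumes "s \<in> S" "set x \<subseteq> S" "set y \<subseteq> S"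
  shows "pres_eq S (coxeter_relators S R) (pos_word (x @ [s, s] @ y)) (pos_word (x @ y))"
proof -
  have "[(s, True), (s, True)] \<in> coxeter_relators S R"
    using assms by (auto simp: coxeter_relators_def)
  then show ?thesis
    using assms pres_eq.relator[of "pos_word x" S "pos_word y" "[(s, True), (s, True)]"] by simp
qed

lemma cox_cong_pres_eq:
  "cox_cong S R u v \<Longrightarrow> set u \<subseteq> S \<Longrightarrow>
    pres_eq S (coxeter_relators S R) (pos_word u) (pos_word v)"
proof (induction rule: cox_cong.induct)
  case (refl u)
  then show ?case by (intro pres_eq.refl) auto
next
  case (sym u v)
  then show ?case using cox_cong_set[OF sym(1)] by (auto intro: pres_eq.sym)
next
  case (trans u v w)
  then show ?case using cox_cong_set[OF trans(1)] by (auto intro: pres_eq.trans)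
next
  case (square s x y)
  then show ?case by (intro pres_eq_pos_word_square) auto
next
  case (braid s t x y)
  let ?E = "\<lambda>u v. pres_eq S (coxeter_relators S R) (pos_word u) (pos_word v)"
  have S: "s \<in> S" "t \<in> S" "set x \<subseteq> S" "set y \<subseteq> S" using braid by auto
  \<comment> \<open>The word \<open>(st)^3 tst\<close> is evaluated twice: cancelling squares from
    its middle leaves \<open>sts\<close>, while removing the relator \<open>(st)^3\<close> leaves
    \<open>tst\<close>. The commutation case does the same with \<open>(st)^2 ts\<close>.\<close>
  have "?E ((x @ [s, t, s, t, s]) @ [t, t] @ [s, t] @ y) ((x @ [s, t, s, t, s]) @ [s, t] @ y)"
    using S by (intro pres_eq_pos_word_square) auto
  moreover have "?E ((x @ [s, t, s, t]) @ [s, s] @ [t] @ y) ((x @ [s, t, s, t]) @ [t] @ y)"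
    using S by (intro pres_eq_pos_word_square) auto
  moreover have "?E ((x @ [s, t, s]) @ [t, t] @ y) ((x @ [s, t, s]) @ y)"
    using S by (intro pres_eq_pos_word_square) auto
  ultimately have "?E (x @ [s, t, s, t, s, t] @ [t, s, t] @ y) (x @ [s, t, s] @ y)"
    by (auto intro: pres_eq.trans)
  moreover have "?E (x @ [s, t, s, t, s, t] @ [t, s, t] @ y) (x @ [t, s, t] @ y)"
  proof -
    have "gen_pow s t 3 \<in> coxeter_relators S R"
      using braid S by (auto simp: coxeter_relators_def)
    moreover have "gen_pow s t 3 = pos_word [s, t, s, t, s, t]"
      by (simp add: gen_pow_def numeral_3_eq_3)
    ultimately show ?thesis
      using S pres_eq.relator[of "pos_word x" S "pos_word ([t, s, t] @ y)" "gen_pow s t 3"] by simp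
  qed
  ultimately show ?case by (auto intro: pres_eq.trans pres_eq.sym)
next
  case (commute s t x y)
  let ?E = "\<lambda>u v. pres_eq S (coxeter_relators S R) (pos_word u) (pos_word v)"
  have S: "s \<in> S" "t \<in> S" "set x \<subseteq> S" "set y \<subseteq> S" using commute by auto
  have "?E ((x @ [s, t, s]) @ [t, t] @ [s] @ y) ((x @ [s, t, s]) @ [s] @ y)"
    using S by (intro pres_eq_pos_word_square) auto
  moreover have "?E ((x @ [s, t]) @ [s, s] @ y) ((x @ [s, t]) @ y)"
    using S by (intro pres_eq_pos_word_square) auto
  ultimately have "?E (x @ [s, t, s, t] @ [t, s] @ y) (x @ [s, t] @ y)"
    by (auto intro: pres_eq.trans)
  moreover have "?E (x @ [s, t, s, t] @ [t, s] @ y) (x @ [t, s] @ y)"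
  proof -
    have "gen_pow s t 2 \<in> coxeter_relators S R"
      using commute S by (auto simp: coxeter_relators_def)
    moreover have "gen_pow s t 2 = pos_word [s, t, s, t]"
      by (simp add: gen_pow_def numeral_2_eq_2)
    ultimately show ?thesis
      using S pres_eq.relator[of "pos_word x" S "pos_word ([t, s] @ y)" "gen_pow s t 2"] by simp
  qed
  ultimately show ?case by (auto intro: pres_eq.trans pres_eq.sym)
qed

text \<open>The relator \<open>s s\<close> makes every generator its own inverse, so formal inverse
  letters can be replaced by positive ones and plain lists reach every element of the group.\<close>

lemma pres_eq_pos_word:
  "w \<in> swords S \<Longrightarrow> pres_eq S (coxeter_relators S R) w (pos_word (map fst w))"
proof (induction w)
  case Nil
  then show ?case by (auto intro: pres_eq.refl)
next
  case (Cons a w)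
  let ?Q = "coxeter_relators S R"
  obtain s b where a: "a = (s, b)" by (cases a)
  have s: "s \<in> S" using Cons.prems a by auto
  have "pres_eq S ?Q [(s, b)] [(s, True)]"
  proof (cases b)
    case True
    then show ?thesis using s by (auto intro: pres_eq.refl)
  next
    case False
    have "[(s, True), (s, True)] \<in> ?Q" using s by (auto simp: coxeter_relators_def)
    then have "pres_eq S ?Q [(s, False), (s, True), (s, True)] [(s, False)]"
      using s pres_eq.relator[of "[(s, False)]" S "[]" "[(s, True), (s, True)]" ?Q] by simp
    moreover have "pres_eq S ?Q [(s, False), (s, True), (s, True)] [(s, True)]"
      using s pres_eq.cancel[of "[]" S "[(s, True)]" s ?Q False] by simp
    ultimately show ?thesis using False by (auto intro: pres_eq.trans pres_eq.sym)
  qed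
  from pres_eq_append[OF this Cons.IH] show ?case using Cons.prems a by simp
qed


section \<open>The signed permutation action\<close>

text \<open>The simple reflections of the root system: for \<open>s < n\<close> the root is
  \<open>e_s - e_(s+1)\<close>, and for \<open>s = n\<close> it is \<open>e_(n-1) + e_n\<close>,
  which is why two signs change there.\<close>

definition D_act_gen :: "nat \<Rightarrow> nat \<Rightarrow> (nat \<Rightarrow> int) \<Rightarrow> nat \<Rightarrow> int"
  where "D_act_gen n s b =
    (if s < n then b(s := b (s + 1), s + 1 := b s) else b(n - 1 := - b n, n := - b (n - 1)))"

definition D_act :: "nat \<Rightarrow> nat list \<Rightarrow> (nat \<Rightarrow> int) \<Rightarrow> nat \<Rightarrow> int"
  where "D_act n u = foldr (D_act_gen n) u"

lemma D_act_simps [simp]: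
  "D_act n [] b = b" "D_act n (s # u) b = D_act_gen n s (D_act n u b)"
  "D_act n (u @ v) b = D_act n u (D_act n v b)"
  by (simp_all add: D_act_def)

lemma D_edges_iff:
  assumes "n \<ge> 4"
  shows "{s, t} \<in> D_edges n \<longleftrightarrow>
    (t = s + 1 \<and> 1 \<le> s \<and> s \<le> n - 2) \<or> (s = t + 1 \<and> 1 \<le> t \<and> t \<le> n - 2) \<or>
    (s = n - 2 \<and> t = n) \<or> (t = n - 2 \<and> s = n)"
  unfolding D_edges_def by (auto simp: doubleton_eq_iff)

lemma D_act_gen_square:
  assumes "n \<ge> 4" "s \<in> {1..n}"
  shows "D_act_gen n s (D_act_gen n s b) = b"
  using assms by (auto simp: D_act_gen_def fun_eq_iff)

lemma D_act_gen_less: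
  "s < n \<Longrightarrow> D_act_gen n s b = (\<lambda>i. if i = s then b (s + 1) else if i = s + 1 then b s else b i)"
  by (auto simp: D_act_gen_def)

lemma D_act_gen_last:
  "n \<ge> 4 \<Longrightarrow> D_act_gen n n b = (\<lambda>i. if i = n then - b (n - 1) else if i = n - 1 then - b n else b i)"
  by (auto simp: D_act_gen_def)

lemma D_act_gen_braid:
  assumes n: "n \<ge> 4" and "s \<in> {1..n}" "t \<in> {1..n}" "{s, t} \<in> D_edges n"
  shows "D_act_gen n s (D_act_gen n t (D_act_gen n s b)) =
    D_act_gen n t (D_act_gen n s (D_act_gen n t b))"
proof -
  have 1: "D_act_gen n s (D_act_gen n (s + 1) (D_act_gen n s b)) =
    D_act_gen n (s + 1) (D_act_gen n s (D_act_gen n (s + 1) b))" if "s + 1 < n" for s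
    using that by (simp add: D_act_gen_less fun_eq_iff)
  have 2: "D_act_gen n (n - 2) (D_act_gen n n (D_act_gen n (n - 2) b)) =
    D_act_gen n n (D_act_gen n (n - 2) (D_act_gen n n b))"
  proof -
    obtain m where m: "n = Suc (Suc m)" "m \<ge> 2"
      using n by (intro that[of "n - 2"]) auto
    then have "D_act_gen n m b' = (\<lambda>i. if i = m then b' (m + 1) else if i = m + 1 then b' m else b' i)" for b'
      by (intro D_act_gen_less) auto
    then show ?thesis
      using m D_act_gen_last[OF n] by (simp add: fun_eq_iff)
  qed
  consider "t = s + 1" "s + 1 < n" | "s = t + 1" "t + 1 < n"
    | "s = n - 2" "t = n" | "t = n - 2" "s = n"
    using assms(4) n unfolding D_edges_iff[OF n] by linarith
  then show ?thesis
    using 1 2 by cases auto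
qed

lemma D_act_gen_commute:
  assumes n: "n \<ge> 4" and "s \<in> {1..n}" "t \<in> {1..n}" "{s, t} \<notin> D_edges n"
  shows "D_act_gen n s (D_act_gen n t b) = D_act_gen n t (D_act_gen n s b)"
proof -
  have 1: "D_act_gen n s (D_act_gen n t b) = D_act_gen n t (D_act_gen n s b)"
    if "s + 1 < t" "t < n" for s t
    using that by (simp add: D_act_gen_less fun_eq_iff)
  have 2: "D_act_gen n s (D_act_gen n n b) = D_act_gen n n (D_act_gen n s b)"
    if "s + 2 < n \<or> s + 1 = n" for s
  proof -
    obtain m where m: "n = Suc m" "m \<ge> 3"
      using n by (intro that[of "n - 1"]) auto
    have "D_act_gen n s b' = (\<lambda>i. if i = s then b' (s + 1) else if i = s + 1 then b' s else b' i)" for b'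
      using that by (intro D_act_gen_less) auto
    then show ?thesis
      using m that D_act_gen_last[OF n] by (auto simp: fun_eq_iff)
  qed
  have 3: "D_act_gen n s (D_act_gen n t b) = D_act_gen n t (D_act_gen n s b)"
    if "s < t" "1 \<le> s" "t \<le> n" "{s, t} \<notin> D_edges n" for s t
  proof (cases "t < n")
    case True
    then have "s + 1 < t" using that n unfolding D_edges_iff[OF n] by linarith
    then show ?thesis using 1 True by blast
  next
    case False
    then have t: "t = n" using that by linarith
    then have "s + 2 < n \<or> s + 1 = n" using that n unfolding D_edges_iff[OF n] by linarith
    then show ?thesis using 2 t by blast
  qed
  have "{t, s} \<notin> D_edges n" using assms(4) by (simp add: insert_commute)
  then show ?thesis
    using assms 3[of s t] 3[of t s] by (cases s t rule: linorder_cases) auto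
qed

text \<open>Forgetting the exponent of a letter by \<open>map fst\<close> is harmless because every
  generator acts as an involution; so the action descends to the presented group.\<close>

lemma D_act_pres_eq:
  assumes n: "n \<ge> 4"
    and "pres_eq (D_vertices n) (coxeter_relators (D_vertices n) (D_edges n)) v w"
  shows "D_act n (map fst v) = D_act n (map fst w)"
  using assms(2)
proof (induction rule: pres_eq.induct)
  case (cancel u v s b)
  then show ?case using D_act_gen_square[OF n] by (intro ext) (simp add: D_vertices_def)
next
  case (relator u v r)
  note sq = D_act_gen_square[OF n] and br = D_act_gen_braid[OF n] and cm = D_act_gen_commute[OF n]
  have "D_act n (map fst r) b = b" for b
  proof -
    consider s where "s \<in> {1..n}" "r = [(s, True), (s, True)]"
      | s t where "s \<in> {1..n}" "t \<in> {1..n}" "{s, t} \<in> D_edges n" "r = gen_pow s t 3"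
      | s t where "s \<in> {1..n}" "t \<in> {1..n}" "{s, t} \<notin> D_edges n" "r = gen_pow s t 2"
      using relator by (auto simp: coxeter_relators_def D_vertices_def)
    then show ?thesis
    proof cases
      case 1
      then show ?thesis using sq by simp
    next
      case 2
      then show ?thesis using sq br[OF 2(1-3)] by (simp add: gen_pow_def numeral_3_eq_3)
    next
      case 3
      then show ?thesis using sq cm[OF 3(1-3)] by (simp add: gen_pow_def numeral_2_eq_2)
    qed
  qed
  then show ?case by (intro ext) simp
qed auto

lemma D_act_cox_cong:
  assumes "n \<ge> 4" "cox_cong {1..n} (D_edges n) u v" "set u \<subseteq> {1..n}"
  shows "D_act n u = D_act n v"
  using D_act_pres_eq[OF assms(1)] cox_cong_pres_eq[OF assms(2,3)]
  by (fastforce simp: D_vertices_def comp_def)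

text \<open>\<open>\<sigma>\<close> and \<open>\<epsilon>\<close> are chosen before
  \<open>b\<close>, so they can be read off later from well-chosen test vectors. Bijectivity of
  \<open>\<sigma>\<close> is not recorded.\<close>

lemma D_act_signed_perm:
  assumes "n \<ge> 4" "set u \<subseteq> {1..n}"
  shows "\<exists>\<sigma> \<epsilon>. \<forall>i\<in>{1..n}. \<sigma> i \<in> {1..n} \<and> (\<epsilon> i = 1 \<or> \<epsilon> i = - 1) \<and> (\<forall>b. D_act n u b i = \<epsilon> i * b (\<sigma> i))"
  using assms(2)
proof (induction u)
  case Nil
  show ?case by (intro exI[of _ "\<lambda>i. i"] exI[of _ "\<lambda>_. 1"]) auto
next
  case (Cons s u)
  have "set u \<subseteq> {1..n}" using Cons.prems by auto
  from Cons.IH[OF this] obtain \<sigma> \<epsilon> where IH: "\<forall>i\<in>{1..n}.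
    \<sigma> i \<in> {1..n} \<and> (\<epsilon> i = 1 \<or> \<epsilon> i = - 1) \<and> (\<forall>b. D_act n u b i = \<epsilon> i * b (\<sigma> i))"
    by blast
  have s: "s \<in> {1..n}" using Cons.prems by auto
  have "\<exists>j e. j \<in> {1..n} \<and> (e = 1 \<or> e = - 1) \<and> (\<forall>b. D_act n (s # u) b i = e * b j)"
    if i: "i \<in> {1..n}" for i
  proof -
    have "\<exists>m\<in>{1..n}. \<exists>d. (d = 1 \<or> d = - 1) \<and> (\<forall>b. D_act_gen n s b i = d * b m)"
    proof -
      consider "s < n" "i = s" | "s < n" "i = s + 1" | "s = n" "i = n" | "s = n" "i = n - 1"
        | "s < n" "i \<noteq> s" "i \<noteq> s + 1" | "s = n" "i \<noteq> n" "i \<noteq> n - 1"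
        using s unfolding atLeastAtMost_iff by linarith
      then show ?thesis
      proof cases
        case 1 then show ?thesis using s i
          by (intro bexI[of _ "s + 1"] exI[of _ 1]) (auto simp: D_act_gen_def)
      next
        case 2 then show ?thesis using s i
          by (intro bexI[of _ s] exI[of _ 1]) (auto simp: D_act_gen_def)
      next
        case 3 then show ?thesis using s i assms(1)
          by (intro bexI[of _ "n - 1"] exI[of _ "- 1"]) (auto simp: D_act_gen_def)
      next
        case 4 then show ?thesis using s i assms(1)
          by (intro bexI[of _ n] exI[of _ "- 1"]) (auto simp: D_act_gen_def)
      qed (use i in \<open>auto simp: D_act_gen_def intro!: bexI[of _ i] exI[of _ 1]\<close>)
    qed
    then obtain m d where md: "m \<in> {1..n}" "d = 1 \<or> d = - 1" "\<And>b. D_act_gen n s b i = d * b m"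
      by blast
    show ?thesis
      using md bspec[OF IH md(1)] by (intro exI[of _ "\<sigma> m"] exI[of _ "d * \<epsilon> m"]) auto
  qed
  then show ?case by metis
qed

section \<open>Coset representatives of consecutive parabolic subgroups\<close>

text \<open>A letter travels through a word and leaves it as another letter: \<open>s\<close>
  commutes past \<open>A\<close>, the braid relation turns \<open>sts\<close> into
  \<open>tst\<close>, and the last \<open>t\<close> commutes past \<open>B\<close>.\<close>

lemma cox_cong_braid_shift:
  assumes "s \<in> S" "t \<in> S" "{s, t} \<in> R"
    and A: "\<forall>a\<in>set A. a \<in> S \<and> s \<noteq> a \<and> {s, a} \<notin> R"
    and B: "\<forall>b\<in>set B. b \<in> S \<and> t \<noteq> b \<and> {t, b} \<notin> R"
  shows "cox_cong S R (s # A @ [t, s] @ B) (A @ [t, s] @ B @ [t])"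
proof -
  have "cox_cong S R (s # A @ [t, s] @ B) (A @ [s, t, s] @ B)"
    using cox_cong_append_right[OF cox_cong_Cons_commute[OF assms(1) A], of "[t, s] @ B"] by simp
  also have "cox_cong S R (A @ [s, t, s] @ B) (A @ [t, s, t] @ B)"
    using assms by (intro cox_cong.braid)
  also have "cox_cong S R (A @ [t, s, t] @ B) (A @ [t, s] @ B @ [t])"
    using cox_cong_append_left[OF cox_cong_Cons_commute[OF assms(2) B], of "A @ [t, s]"] by simp
  finally show ?thesis .
qed

text \<open>The move peculiar to a branch point \<open>q\<close> with unjoined neighbours
  \<open>p\<close> and \<open>r\<close>: \<open>pqrpq = pqprq = qpqrq = qprqr = qrpqr\<close>. The
  letter enters as one leaf and leaves as the other.\<close>

lemma cox_cong_fork_shift: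
  assumes "p \<in> S" "q \<in> S" "r \<in> S" "p \<noteq> r" "{p, r} \<notin> R" "{p, q} \<in> R" "{q, r} \<in> R"
    and A: "\<forall>a\<in>set A. a \<in> S \<and> p \<noteq> a \<and> {p, a} \<notin> R"
    and B: "\<forall>b\<in>set B. b \<in> S \<and> r \<noteq> b \<and> {r, b} \<notin> R"
  shows "cox_cong S R (p # A @ [q, r, p, q] @ B) (A @ [q, r, p, q] @ B @ [r])"
proof -
  have sw: "{r, p} \<notin> R" "{r, q} \<in> R" "{q, p} \<in> R" using assms by (simp_all add: insert_commute)
  have "cox_cong S R (p # A @ [q, r, p, q] @ B) (A @ [p, q, r, p, q] @ B)"
    using cox_cong_append_right[OF cox_cong_Cons_commute[OF assms(1) A], of "[q, r, p, q] @ B"] by simp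
  also have "cox_cong S R (A @ [p, q, r, p, q] @ B) (A @ [p, q, p, r, q] @ B)"
    using cox_cong.commute[of r S p R "A @ [p, q]" "q # B"] assms sw by simp
  also have "cox_cong S R (A @ [p, q, p, r, q] @ B) (A @ [q, p, q, r, q] @ B)"
    using cox_cong.braid[of p S q R "A" "r # q # B"] assms by simp
  also have "cox_cong S R (A @ [q, p, q, r, q] @ B) (A @ [q, p, r, q, r] @ B)"
    using cox_cong.braid[of q S r R "A @ [q, p]" B] assms by simp
  also have "cox_cong S R (A @ [q, p, r, q, r] @ B) (A @ [q, r, p, q, r] @ B)"
    using cox_cong.commute[of p S r R "A @ [q]" "q # r # B"] assms sw by simp
  also have "cox_cong S R (A @ [q, r, p, q, r] @ B) (A @ [q, r, p, q] @ B @ [r])"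
    using cox_cong_append_left[OF cox_cong_Cons_commute[OF assms(3) B], of "A @ [q, r, p, q]"] by simp
  finally show ?thesis .
qed

abbreviation D_cong :: "nat \<Rightarrow> nat list \<Rightarrow> nat list \<Rightarrow> bool"
  where "D_cong n \<equiv> cox_cong {1..n} (D_edges n)"

lemma D_edge_path: "n \<ge> 4 \<Longrightarrow> 1 \<le> i \<Longrightarrow> i + 1 < n \<Longrightarrow> {i, i + 1} \<in> D_edges n"
  by (simp add: D_edges_iff)

lemma D_edge_fork: "n \<ge> 4 \<Longrightarrow> {n - 2, n} \<in> D_edges n"
  by (simp add: D_edges_iff)

lemma D_nonedge_path:
  "n \<ge> 4 \<Longrightarrow> i < n \<Longrightarrow> j < n \<Longrightarrow> i + 1 < j \<or> j + 1 < i \<Longrightarrow> {i, j} \<notin> D_edges n"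
  unfolding D_edges_iff by linarith

lemma D_nonedge_fork: "n \<ge> 4 \<Longrightarrow> i + 2 < n \<or> i + 1 = n \<Longrightarrow> {i, n} \<notin> D_edges n"
  unfolding D_edges_iff by linarith

lemma D_nonedge_fork': "n \<ge> 4 \<Longrightarrow> i + 2 < n \<or> i + 1 = n \<Longrightarrow> {n, i} \<notin> D_edges n"
  unfolding D_edges_iff by linarith

lemmas D_nonedges = D_nonedge_path D_nonedge_fork D_nonedge_fork'

lemma upt_split: "i \<le> j \<Longrightarrow> j \<le> k \<Longrightarrow> [i..<k] = [i..<j] @ [j..<k]" for i j k :: nat
  using upt_add_eq_append[of i j "k - j"] by simp

lemma upt_split_pair:
  assumes "j \<le> i" "i + 1 < m"
  shows "[j..<m] = [j..<i] @ [i, i + 1] @ [i + 2..<m]"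
proof -
  have "[j..<m] = [j..<i] @ [i..<m]"
    using upt_split[of j i m] assms by simp
  also have "[i..<m] = [i, i + 1] @ [i + 2..<m]"
    using assms by (simp add: upt_conv_Cons)
  finally show ?thesis .
qed

text \<open>The descending word acts as a cycle of consecutive coordinates, so conjugation by it
  shifts an adjacent transposition by one place. The ascending word in \<open>D_shift_up\<close>
  shifts in the opposite direction.\<close>

lemma D_shift_down:
  assumes "n \<ge> 4" "1 \<le> k" "k \<le> i" "i + 1 < j" "j \<le> n"
  shows "D_cong n (i # rev [k..<j]) (rev [k..<j] @ [i + 1])"
proof -
  have "D_cong n (i # rev [i + 2..<j] @ [i + 1, i] @ rev [k..<i])
      (rev [i + 2..<j] @ [i + 1, i] @ rev [k..<i] @ [i + 1])"
    using assms by (intro cox_cong_braid_shift D_edge_path ballI conjI D_nonedge_path) auto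
  then show ?thesis using upt_split_pair[OF assms(3,4)] by simp
qed

lemma D_shift_up:
  assumes "n \<ge> 4" "1 \<le> j" "j < i" "i < m" "m < n"
  shows "D_cong n (i # [j..<m]) ([j..<m] @ [i - 1])"
proof -
  obtain l where l: "i = l + 1" "j \<le> l" using assms by (intro that[of "i - 1"]) auto
  have "{l + 1, l} \<in> D_edges n" using D_edge_path[of n l] assms l by (simp add: insert_commute)
  then have "D_cong n ((l + 1) # [j..<l] @ [l, l + 1] @ [l + 2..<m])
      ([j..<l] @ [l, l + 1] @ [l + 2..<m] @ [l])"
    using assms l by (intro cox_cong_braid_shift D_edge_path ballI conjI D_nonedge_path) auto
  then show ?thesis using upt_split_pair[of j l m] assms l by simp
qed

text \<open>The minimal representatives modulo the parabolic subgroup on the vertices above \<open>k\<close>: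
  the first ones send the \<open>k\<close>-th basis vector to the \<open>j\<close>-th, the others to minus the \<open>n\<close>-th and
  minus the \<open>j\<close>-th.\<close>

definition D_cosets :: "nat \<Rightarrow> nat \<Rightarrow> nat list set"
  where "D_cosets n k = {rev [k..<j] | j. k \<le> j \<and> j \<le> n} \<union> {n # rev [k..<n - 1]} \<union>
    {[j..<n - 1] @ [n] @ rev [k..<n] | j. k \<le> j \<and> j < n}"

lemma D_cosets_intros:
  "k \<le> j \<Longrightarrow> j \<le> n \<Longrightarrow> rev [k..<j] \<in> D_cosets n k"
  "n # rev [k..<n - 1] \<in> D_cosets n k"
  "k \<le> j \<Longrightarrow> j < n \<Longrightarrow> [j..<n - 1] @ [n] @ rev [k..<n] \<in> D_cosets n k"
  by (auto simp: D_cosets_def)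

lemma rev_upt_Cons: "k < j \<Longrightarrow> rev [k..<j] = (j - 1) # rev [k..<j - 1]"
  by (cases j) auto

text \<open>The cosets correspond to the orbit of the \<open>k\<close>-th basis vector. A letter
  that moves the orbit point leads to a neighbouring representative with \<open>h\<close> empty; a
  letter that fixes it passes through the representative and comes out on the right as a single
  letter above \<open>k\<close>.\<close>

lemma D_coset_step_pos:
  assumes n: "n \<ge> 4" and k: "1 \<le> k" "k \<le> n - 2" and i: "k \<le> i" "i \<le> n" and j: "k \<le> j" "j \<le> n"
  shows "\<exists>c'\<in>D_cosets n k. \<exists>h. set h \<subseteq> {k + 1..n} \<and> D_cong n (i # rev [k..<j]) (c' @ h)"
proof -
  consider "i = j" "j < n" | "i + 1 = j" | "i + 1 < j" | "j < i" "i < n"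
    | "i = n" "j + 2 \<le> n" | "i = n" "j = n - 1" | "i = n" "j = n"
    using i j by linarith
  then show ?thesis
  proof cases
    case 1
    then have "i # rev [k..<j] = rev [k..<j + 1] @ []" using j by simp
    then show ?thesis using 1 j D_cosets_intros(1)[of k "j + 1" n]
      by (intro bexI[of _ "rev [k..<j + 1]"] exI[of _ "[]"]) (auto simp: cox_cong.refl)
  next
    case 2
    then have "i # rev [k..<j] = [] @ [i, i] @ rev [k..<i]" using i by auto
    moreover have "D_cong n ([] @ [i, i] @ rev [k..<i]) ([] @ rev [k..<i])"
      using i k by (intro cox_cong.square) auto
    ultimately show ?thesis using 2 i D_cosets_intros(1)[of k i n]
      by (intro bexI[of _ "rev [k..<i]"] exI[of _ "[]"]) auto
  next
    case 3
    then show ?thesis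
      using D_shift_down[of n k i j] n k i j D_cosets_intros(1)[of k j n]
      by (intro bexI[of _ "rev [k..<j]"] exI[of _ "[i + 1]"]) auto
  next
    case 4
    then have "D_cong n (i # rev [k..<j]) (rev [k..<j] @ [i])"
      using n k j by (intro cox_cong_Cons_commute ballI conjI D_nonedges) auto
    then show ?thesis using 4 j D_cosets_intros(1)[of k j n]
      by (intro bexI[of _ "rev [k..<j]"] exI[of _ "[i]"]) auto
  next
    case 5
    then have "D_cong n (n # rev [k..<j]) (rev [k..<j] @ [n])"
      using n k j by (intro cox_cong_Cons_commute ballI conjI D_nonedges) auto
    then show ?thesis using 5 k j n D_cosets_intros(1)[of k j n]
      by (intro bexI[of _ "rev [k..<j]"] exI[of _ "[n]"]) auto
  next
    case 6
    then show ?thesis using D_cosets_intros(2)[of n k]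
      by (intro bexI[of _ "n # rev [k..<n - 1]"] exI[of _ "[]"]) (auto simp: cox_cong.refl)
  next
    case 7
    have "[n - 1..<n - 1] @ [n] @ rev [k..<n] \<in> D_cosets n k"
      using n k by (intro D_cosets_intros) auto
    then show ?thesis using 7
      by (intro bexI[of _ "n # rev [k..<n]"] exI[of _ "[]"]) (auto simp: cox_cong.refl)
  qed
qed

text \<open>The orbit point is \<open>-e_n\<close>. The letter \<open>n\<close> leads back to
  \<open>e_(n-1)\<close>, the letter \<open>n - 1\<close> leads on to \<open>-e_(n-1)\<close>, and
  all others fix the point.\<close>

lemma D_coset_step_mid:
  assumes n: "n \<ge> 4" and k: "1 \<le> k" "k \<le> n - 2" and i: "k \<le> i" "i \<le> n"
  shows "\<exists>c'\<in>D_cosets n k. \<exists>h. set h \<subseteq> {k + 1..n} \<and> D_cong n (i # n # rev [k..<n - 1]) (c' @ h)"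
proof -
  consider "i = n" | "i = n - 1" | "i = n - 2" | "i < n - 2"
    using i by linarith
  then show ?thesis
  proof cases
    case 1
    have "D_cong n ([] @ [n, n] @ rev [k..<n - 1]) ([] @ rev [k..<n - 1])"
      using n by (intro cox_cong.square) auto
    then show ?thesis using 1 k D_cosets_intros(1)[of k "n - 1" n]
      by (intro bexI[of _ "rev [k..<n - 1]"] exI[of _ "[]"]) auto
  next
    case 2
    have "D_cong n ([] @ [n - 1, n] @ rev [k..<n - 1]) ([] @ [n, n - 1] @ rev [k..<n - 1])"
      using n by (intro cox_cong.commute D_nonedges) auto
    moreover have "[n - 1..<n - 1] @ [n] @ rev [k..<n] \<in> D_cosets n k"
      using n k by (intro D_cosets_intros) auto
    ultimately show ?thesis using 2 k n rev_upt_Cons[of k n]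
      by (intro bexI[of _ "n # rev [k..<n]"] exI[of _ "[]"]) auto
  next
    case 3
    have "D_cong n ((n - 2) # [] @ [n, n - 2] @ rev [k..<n - 2]) ([] @ [n, n - 2] @ rev [k..<n - 2] @ [n])"
      using n k by (intro cox_cong_braid_shift D_edge_fork ballI conjI D_nonedges) auto
    moreover have "rev [k..<n - 1] = (n - 2) # rev [k..<n - 2]"
      using rev_upt_Cons[of k "n - 1"] k n by (simp add: numeral_2_eq_2)
    ultimately show ?thesis using 3 k n D_cosets_intros(2)[of n k]
      by (intro bexI[of _ "n # rev [k..<n - 1]"] exI[of _ "[n]"]) auto
  next
    case 4
    have "D_cong n ([] @ [i, n] @ rev [k..<n - 1]) ([] @ [n, i] @ rev [k..<n - 1])"
      using n k i 4 by (intro cox_cong.commute D_nonedges) auto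
    also have "D_cong n ([] @ [n, i] @ rev [k..<n - 1]) ([n] @ rev [k..<n - 1] @ [i + 1])"
      using cox_cong_append_left[OF D_shift_down[of n k i "n - 1"], of "[n]"] n k i 4 by simp
    finally show ?thesis using 4 i D_cosets_intros(2)[of n k]
      by (intro bexI[of _ "n # rev [k..<n - 1]"] exI[of _ "[i + 1]"]) auto
  qed
qed

text \<open>For \<open>j \<le> n - 2\<close> the representative also negates the last coordinate and
  fixes coordinate \<open>n - 1\<close>, so conjugation by it interchanges the leaves:
  \<open>n - 1\<close> comes out as \<open>n\<close> and conversely. These are the two cases that
  need \<open>cox_cong_fork_shift\<close>.\<close>

lemma D_coset_step_neg:
  assumes n: "n \<ge> 4" and k: "1 \<le> k" "k \<le> n - 2" and i: "k \<le> i" "i \<le> n" and j: "k \<le> j" "j < n"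
  shows "\<exists>c'\<in>D_cosets n k. \<exists>h. set h \<subseteq> {k + 1..n} \<and>
    D_cong n (i # [j..<n - 1] @ [n] @ rev [k..<n]) (c' @ h)"
proof -
  have mem: "[j..<n - 1] @ [n] @ rev [k..<n] \<in> D_cosets n k"
    using j by (intro D_cosets_intros) auto
  have rv: "rev [k..<n] = (n - 1) # rev [k..<n - 1]" "rev [k..<n - 1] = (n - 2) # rev [k..<n - 2]"
    using rev_upt_Cons[of k n] rev_upt_Cons[of k "n - 1"] k n by (simp_all add: numeral_2_eq_2)
  have E: "{n - 1, n} \<notin> D_edges n" "{n, n - 1} \<notin> D_edges n"
    "{n - 1, n - 2} \<in> D_edges n" "{n - 2, n - 1} \<in> D_edges n"
    "{n, n - 2} \<in> D_edges n" "{n - 2, n} \<in> D_edges n"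
    unfolding D_edges_iff[OF n] using n by linarith+
  have S: "n - 1 \<in> {1..n}" "n - 2 \<in> {1..n}" "n \<in> {1..n}" "n - 1 \<noteq> n" "n \<noteq> n - 1"
    using n by auto
  have F: "\<forall>a\<in>set [m..<n - 2]. a \<in> {1..n} \<and> n - 1 \<noteq> a \<and> {n - 1, a} \<notin> D_edges n"
    "\<forall>a\<in>set [m..<n - 2]. a \<in> {1..n} \<and> n \<noteq> a \<and> {n, a} \<notin> D_edges n" if "1 \<le> m" for m
    using n that by (intro ballI conjI D_nonedges; auto)+
  then have F: "\<forall>a\<in>set [j..<n - 2]. a \<in> {1..n} \<and> n - 1 \<noteq> a \<and> {n - 1, a} \<notin> D_edges n"
    "\<forall>a\<in>set [j..<n - 2]. a \<in> {1..n} \<and> n \<noteq> a \<and> {n, a} \<notin> D_edges n"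
    "\<forall>a\<in>set (rev [k..<n - 2]). a \<in> {1..n} \<and> n - 1 \<noteq> a \<and> {n - 1, a} \<notin> D_edges n"
    "\<forall>a\<in>set (rev [k..<n - 2]). a \<in> {1..n} \<and> n \<noteq> a \<and> {n, a} \<notin> D_edges n"
    using j k unfolding set_rev by (meson le_trans)+
  consider "i = n - 1" "j = n - 1" | "i = n" "j = n - 1" | "i = j" "j < n - 1" | "i + 1 = j"
    | "i + 1 < j" | "j < i" "i \<le> n - 2" | "i = n - 1" "j \<le> n - 2" | "i = n" "j \<le> n - 2"
  proof (cases "j = n - 1")
    case True
    have "i = n - 1 \<or> i = n \<or> i + 1 = j \<or> i + 1 < j" using i True by linarith
    then show ?thesis using that True by blast
  next
    case False
    have "i = j \<or> i + 1 = j \<or> i + 1 < j \<or> j < i \<and> i \<le> n - 2 \<or> i = n - 1 \<or> i = n"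
      using i by linarith
    moreover have "j < n - 1" "j \<le> n - 2" using False j by auto
    ultimately show ?thesis using that by blast
  qed
  then show ?thesis
  proof cases
    case 1
    have "D_cong n ([] @ [n - 1, n] @ (n - 1) # rev [k..<n - 1]) ([] @ [n, n - 1] @ (n - 1) # rev [k..<n - 1])"
      using n by (intro cox_cong.commute D_nonedges) auto
    also have "D_cong n ([] @ [n, n - 1] @ (n - 1) # rev [k..<n - 1]) ([n] @ rev [k..<n - 1])"
      using cox_cong.square[of "n - 1" "{1..n}" "D_edges n" "[n]" "rev [k..<n - 1]"] n by auto
    finally show ?thesis using 1 D_cosets_intros(2)[of n k] rv(1)
      by (intro bexI[of _ "n # rev [k..<n - 1]"] exI[of _ "[]"]) auto
  next
    case 2
    have "D_cong n ([] @ [n, n] @ rev [k..<n]) ([] @ rev [k..<n])"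
      using n by (intro cox_cong.square) auto
    then show ?thesis using 2 k n D_cosets_intros(1)[of k n n]
      by (intro bexI[of _ "rev [k..<n]"] exI[of _ "[]"]) auto
  next
    case 3
    have "D_cong n ([] @ [j, j] @ [j + 1..<n - 1] @ [n] @ rev [k..<n])
        ([] @ [j + 1..<n - 1] @ [n] @ rev [k..<n])"
      using k j by (intro cox_cong.square) auto
    moreover have "[j..<n - 1] = j # [j + 1..<n - 1]" using 3 by (simp add: upt_conv_Cons)
    ultimately show ?thesis using 3 j D_cosets_intros(3)[of k "j + 1" n]
      by (intro bexI[of _ "[j + 1..<n - 1] @ [n] @ rev [k..<n]"] exI[of _ "[]"]) auto
  next
    case 4
    then have "i # [j..<n - 1] = [i..<n - 1]" using j by (auto simp: upt_conv_Cons)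
    then have "i # [j..<n - 1] @ [n] @ rev [k..<n] = ([i..<n - 1] @ [n] @ rev [k..<n]) @ []"
      by (metis append_Cons append_Nil2)
    then have "D_cong n (i # [j..<n - 1] @ [n] @ rev [k..<n]) (([i..<n - 1] @ [n] @ rev [k..<n]) @ [])"
      by (simp only: cox_cong.refl)
    moreover have "[i..<n - 1] @ [n] @ rev [k..<n] \<in> D_cosets n k"
      using 4 i j by (intro D_cosets_intros) auto
    moreover have "set [] \<subseteq> {k + 1..n}" by simp
    ultimately show ?thesis by blast
  next
    case 5
    have "D_cong n (i # [j..<n - 1] @ [n]) (([j..<n - 1] @ [n]) @ [i])"
      using k i j 5 D_nonedge_path[OF n] D_nonedge_fork[OF n]
      by (intro cox_cong_Cons_commute) auto
    from cox_cong_append_right[OF this, of "rev [k..<n]"]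
    have "D_cong n (i # [j..<n - 1] @ [n] @ rev [k..<n]) ([j..<n - 1] @ [n] @ i # rev [k..<n])"
      by simp
    also have "D_cong n ([j..<n - 1] @ [n] @ i # rev [k..<n]) ([j..<n - 1] @ [n] @ rev [k..<n] @ [i + 1])"
      using n k i j 5 by (intro cox_cong_append_left D_shift_down) auto
    finally show ?thesis using 5 i j mem
      by (intro bexI[of _ "[j..<n - 1] @ [n] @ rev [k..<n]"] exI[of _ "[i + 1]"]) auto
  next
    case 6
    have "D_cong n (i # [j..<n - 1] @ [n] @ rev [k..<n]) ([j..<n - 1] @ [i - 1, n] @ rev [k..<n])"
      using cox_cong_append_right[OF D_shift_up[of n j i "n - 1"], of "[n] @ rev [k..<n]"] n k j 6
      by simp
    also have "D_cong n ([j..<n - 1] @ [i - 1, n] @ rev [k..<n]) ([j..<n - 1] @ [n, i - 1] @ rev [k..<n])"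
      using n k j 6 by (intro cox_cong.commute D_nonedges) auto
    also have "D_cong n ([j..<n - 1] @ [n, i - 1] @ rev [k..<n]) ([j..<n - 1] @ [n] @ rev [k..<n] @ [i])"
      using cox_cong_append_left[OF D_shift_down[of n k "i - 1" n], of "[j..<n - 1] @ [n]"] n k j 6
      by simp
    finally show ?thesis using 6 i j mem
      by (intro bexI[of _ "[j..<n - 1] @ [n] @ rev [k..<n]"] exI[of _ "[i]"]) auto
  next
    case 7
    have eq: "[j..<n - 1] @ [n] @ rev [k..<n] = [j..<n - 2] @ [n - 2, n, n - 1, n - 2] @ rev [k..<n - 2]"
      using rv upt_split[of j "n - 2" "n - 1"] 7 n by (simp add: upt_conv_Cons)
    have "D_cong n ((n - 1) # [j..<n - 2] @ [n - 2, n, n - 1, n - 2] @ rev [k..<n - 2])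
        ([j..<n - 2] @ [n - 2, n, n - 1, n - 2] @ rev [k..<n - 2] @ [n])"
      using cox_cong_fork_shift[OF S(1,2,3,4) E(1,3,6) F(1,4)] .
    then have "D_cong n (i # [j..<n - 1] @ [n] @ rev [k..<n]) (([j..<n - 1] @ [n] @ rev [k..<n]) @ [n])"
      unfolding eq using 7 by simp
    then show ?thesis using k n mem
      by (intro bexI[of _ "[j..<n - 1] @ [n] @ rev [k..<n]"] exI[of _ "[n]"]) auto
  next
    case 8
    have eq: "[j..<n - 1] @ [n] @ rev [k..<n] = [j..<n - 2] @ [n - 2, n, n - 1, n - 2] @ rev [k..<n - 2]"
      using rv upt_split[of j "n - 2" "n - 1"] 8 n by (simp add: upt_conv_Cons)
    \<comment> \<open>The fork move for the letter \<open>n\<close> expects the two leaves in the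
      other order; as they commute, they are swapped before the move and swapped back after
      it.\<close>
    have sw: "D_cong n (x @ [n, n - 1] @ y) (x @ [n - 1, n] @ y)" for x y
      using n by (intro cox_cong.commute D_nonedges) auto
    have "D_cong n (n # [j..<n - 2] @ [n - 2, n, n - 1, n - 2] @ rev [k..<n - 2])
        (n # [j..<n - 2] @ [n - 2, n - 1, n, n - 2] @ rev [k..<n - 2])"
      using sw[of "n # [j..<n - 2] @ [n - 2]" "(n - 2) # rev [k..<n - 2]"] by simp
    also have "D_cong n (n # [j..<n - 2] @ [n - 2, n - 1, n, n - 2] @ rev [k..<n - 2])
        ([j..<n - 2] @ [n - 2, n - 1, n, n - 2] @ rev [k..<n - 2] @ [n - 1])"
      using cox_cong_fork_shift[OF S(3,2,1,5) E(2,5,4) F(2,3)] .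
    also have "D_cong n ([j..<n - 2] @ [n - 2, n - 1, n, n - 2] @ rev [k..<n - 2] @ [n - 1])
        ([j..<n - 2] @ [n - 2, n, n - 1, n - 2] @ rev [k..<n - 2] @ [n - 1])"
      using cox_cong.sym[OF sw[of "[j..<n - 2] @ [n - 2]" "(n - 2) # rev [k..<n - 2] @ [n - 1]"]] by simp
    finally have "D_cong n (i # [j..<n - 1] @ [n] @ rev [k..<n]) (([j..<n - 1] @ [n] @ rev [k..<n]) @ [n - 1])"
      unfolding eq using 8 by simp
    then show ?thesis using k n mem
      by (intro bexI[of _ "[j..<n - 1] @ [n] @ rev [k..<n]"] exI[of _ "[n - 1]"]) auto
  qed
qed

text \<open>Induction on the word: each new first letter is absorbed by the current representative,
  and what it leaves behind is put in front of \<open>h\<close>.\<close>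

lemma D_coset_decomposition:
  assumes n: "n \<ge> 4" and k: "1 \<le> k" "k \<le> n - 2"
  shows "set w \<subseteq> {k..n} \<Longrightarrow>
    \<exists>c\<in>D_cosets n k. \<exists>h. set h \<subseteq> {k + 1..n} \<and> D_cong n w (c @ h)"
proof (induction w)
  case Nil
  show ?case using k D_cosets_intros(1)[of k k n]
    by (intro bexI[of _ "[]"] exI[of _ "[]"]) (auto simp: cox_cong.refl)
next
  case (Cons i w)
  then obtain c h where ch: "c \<in> D_cosets n k" "set h \<subseteq> {k + 1..n}" "D_cong n w (c @ h)"
    by auto
  have i: "k \<le> i" "i \<le> n" using Cons.prems by auto
  have "\<exists>c'\<in>D_cosets n k. \<exists>h'. set h' \<subseteq> {k + 1..n} \<and> D_cong n (i # c) (c' @ h')"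
  proof -
    from ch(1) consider j where "k \<le> j" "j \<le> n" "c = rev [k..<j]" | "c = n # rev [k..<n - 1]"
      | j where "k \<le> j" "j < n" "c = [j..<n - 1] @ [n] @ rev [k..<n]"
      unfolding D_cosets_def by blast
    then show ?thesis
    proof cases
      case 1
      show ?thesis unfolding 1(3) by (rule D_coset_step_pos[OF n k i 1(1,2)])
    next
      case 2
      show ?thesis unfolding 2 by (rule D_coset_step_mid[OF n k i])
    next
      case 3
      show ?thesis unfolding 3(3) by (rule D_coset_step_neg[OF n k i 3(1,2)])
    qed
  qed
  then obtain c' h' where ch': "c' \<in> D_cosets n k" "set h' \<subseteq> {k + 1..n}" "D_cong n (i # c) (c' @ h')"
    by auto
  have "D_cong n (i # w) (i # c @ h)" using ch(3) by (rule cox_cong_Cons)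
  also have "D_cong n (i # c @ h) (c' @ (h' @ h))"
    using cox_cong_append_right[OF ch'(3), of h] by simp
  finally show ?case using ch ch'
    by (intro bexI[of _ c'] exI[of _ "h' @ h"]) auto
qed

section \<open>Faithfulness of the signed permutation action\<close>

abbreviation D_basis :: "nat \<Rightarrow> nat \<Rightarrow> int"
  where "D_basis k \<equiv> (\<lambda>i. of_bool (i = k))"

text \<open>The bound \<open>k + 2 \<le> n\<close> matters because the generator \<open>n\<close>
  moves coordinate \<open>n - 1\<close> as well as coordinate \<open>n\<close>.\<close>

lemma D_act_basis_fix:
  assumes "n \<ge> 4" "k + 2 \<le> n"
  shows "set h \<subseteq> {k + 1..n} \<Longrightarrow> D_act n h (D_basis k) = D_basis k"
proof (induction h)
  case (Cons s h)
  then have "D_act_gen n s (D_basis k) = D_basis k"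
    using assms by (auto simp: D_act_gen_def fun_eq_iff)
  then show ?case using Cons by auto
qed auto

lemma D_act_coset_pos:
  assumes "n \<ge> 4" "k \<le> j" "j \<le> n"
  shows "D_act n (rev [k..<j]) (D_basis k) = D_basis j"
  using assms(2,3)
proof (induction j rule: dec_induct)
  case (step j)
  then show ?case by (auto simp: D_act_gen_def fun_eq_iff)
qed auto

lemma D_act_coset_mid:
  assumes "n \<ge> 4" "k \<le> n - 1"
  shows "D_act n (n # rev [k..<n - 1]) (D_basis k) = (\<lambda>i. - D_basis n i)"
proof -
  have "D_act n (rev [k..<n - 1]) (D_basis k) = D_basis (n - 1)"
    using assms by (intro D_act_coset_pos) auto
  then have "D_act n (n # rev [k..<n - 1]) (D_basis k) = D_act_gen n n (D_basis (n - 1))" by simp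
  also have "\<dots> = (\<lambda>i. - D_basis n i)"
    using assms by (auto simp: D_act_gen_def fun_eq_iff)
  finally show ?thesis .
qed

lemma D_act_coset_neg:
  assumes n: "n \<ge> 4" and "k \<le> j" "j < n"
  shows "D_act n ([j..<n - 1] @ [n] @ rev [k..<n]) (D_basis k) = (\<lambda>i. - D_basis j i)"
proof -
  have "D_act n (rev [k..<n]) (D_basis k) = D_basis n"
    using assms by (intro D_act_coset_pos) auto
  moreover have "D_act_gen n n (D_basis n) = (\<lambda>i. - D_basis (n - 1) i)"
    using assms by (auto simp: D_act_gen_def fun_eq_iff)
  ultimately have 1: "D_act n ([n] @ rev [k..<n]) (D_basis k) = (\<lambda>i. - D_basis (n - 1) i)"
    by simp
  have "j \<le> n - 1" using assms by simp
  then have "D_act n [j..<n - 1] (\<lambda>i. - D_basis (n - 1) i) = (\<lambda>i. - D_basis j i)"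
  proof (induction j rule: inc_induct)
    case (step j)
    have "[j..<n - 1] = j # [Suc j..<n - 1]" using step.hyps by (simp add: upt_conv_Cons)
    then have "D_act n [j..<n - 1] (\<lambda>i. - D_basis (n - 1) i) = D_act_gen n j (\<lambda>i. - D_basis (Suc j) i)"
      using step.IH by simp
    also have "\<dots> = (\<lambda>i. - D_basis j i)"
      using step.hyps by (auto simp: D_act_gen_def fun_eq_iff)
    finally show ?case .
  qed simp
  then show ?thesis using 1 by simp
qed

lemma D_coset_trivial:
  assumes n: "n \<ge> 4" and k: "k \<le> n - 2" and c: "c \<in> D_cosets n k"
    and stab: "D_act n c (D_basis k) = D_basis k"
  shows "c = []"
proof -
  from c consider j where "k \<le> j" "j \<le> n" "c = rev [k..<j]" | "c = n # rev [k..<n - 1]"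
    | j where "k \<le> j" "j < n" "c = [j..<n - 1] @ [n] @ rev [k..<n]"
    unfolding D_cosets_def by blast
  then show ?thesis
  proof cases
    case 1
    then have "D_basis j = D_basis k" using D_act_coset_pos[OF n 1(1,2)] stab by simp
    from fun_cong[OF this, of k] show ?thesis using 1 by (simp split: if_splits)
  next
    case 2
    then have "(\<lambda>i. - D_basis n i) = D_basis k" using D_act_coset_mid[of n k] n k stab by simp
    from fun_cong[OF this, of k] show ?thesis by (simp add: of_bool_def split: if_splits)
  next
    case 3
    then have "(\<lambda>i. - D_basis j i) = D_basis k" using D_act_coset_neg[OF n 3(1,2)] stab by simp
    from fun_cong[OF this, of k] show ?thesis by (simp add: of_bool_def split: if_splits)
  qed
qed

text \<open>The descent has to stop at \<open>k = n - 1\<close>, since the generator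
  \<open>n\<close> no longer fixes that basis vector. The remaining two leaves commute, so at most
  the four words of a Klein four-group are left.\<close>

lemma D_cong_last_two:
  assumes n: "n \<ge> 4"
  shows "set w \<subseteq> {n - 1..n} \<Longrightarrow>
    D_cong n w [] \<or> D_cong n w [n - 1] \<or> D_cong n w [n] \<or> D_cong n w [n - 1, n]"
proof (induction w)
  case Nil
  show ?case by (simp add: cox_cong.refl)
next
  case (Cons s w)
  have s: "s = n - 1 \<or> s = n" using Cons.prems by auto
  have sq: "D_cong n (t # t # y) y" if "t = n - 1 \<or> t = n" for t y
    using cox_cong.square[of t "{1..n}" "D_edges n" "[]" y] that n by auto
  have cm: "D_cong n (n # (n - 1) # y) ((n - 1) # n # y)" for y
    using cox_cong.commute[of n "{1..n}" "n - 1" "D_edges n" "[]" y] D_nonedge_fork'[OF n, of "n - 1"] n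
    by auto
  have cmn: "D_cong n [n, n - 1, n] [n - 1]"
    using cox_cong.trans[OF cm[of "[n]"] cox_cong_Cons[OF sq[of n "[]"], of "n - 1"]] by simp
  from Cons consider "D_cong n w []" | "D_cong n w [n - 1]" | "D_cong n w [n]" | "D_cong n w [n - 1, n]"
    by auto
  then show ?case
  proof cases
    case 1
    from cox_cong_Cons[OF this, of s] show ?thesis using s by auto
  next
    case 2
    from cox_cong_Cons[OF this, of s] show ?thesis using s sq[of "n - 1" "[]"] cm[of "[]"]
      by (metis cox_cong.trans)
  next
    case 3
    from cox_cong_Cons[OF this, of s] show ?thesis using s sq[of n "[]"]
      by (metis cox_cong.trans)
  next
    case 4
    from cox_cong_Cons[OF this, of s] show ?thesis using s sq[of "n - 1" "[n]"] cmn
      by (metis cox_cong.trans)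
  qed
qed

lemma D_act_trivial:
  assumes n: "n \<ge> 4" and "set w \<subseteq> {1..n}" "D_act n w = (\<lambda>b. b)"
  shows "D_cong n w []"
proof -
  have "\<forall>w. set w \<subseteq> {k..n} \<longrightarrow> D_act n w = (\<lambda>b. b) \<longrightarrow> D_cong n w []"
    if "k \<le> n - 1" "1 \<le> k" for k
    using that
  proof (induction k rule: inc_induct)
    case base
    show ?case
    proof (intro allI impI)
      fix w assume w: "set w \<subseteq> {n - 1..n}" "D_act n w = (\<lambda>b. b)"
      have "{n - 1..n} \<subseteq> {1..n}" using n by auto
      then have sub: "set w \<subseteq> {1..n}" using w(1) by blast
      have ne: "n - 1 \<noteq> n" using n by simp
      have "\<not> D_cong n w v" if "v \<in> {[n - 1], [n], [n - 1, n]}" for v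
      proof
        assume "D_cong n w v"
        then have "D_act n v = (\<lambda>b. b)" using D_act_cox_cong[OF n, of w v] w sub by simp
        \<comment> \<open>The three nontrivial words send \<open>e_n\<close> to
          \<open>e_(n-1)\<close>, \<open>-e_(n-1)\<close> and \<open>-e_n\<close>, so none of them
          keeps the entry 1 at position \<open>n\<close>.\<close>
        then have "D_act n v (D_basis n) n = 1" by simp
        moreover have "D_act n v (D_basis n) n \<noteq> 1"
          using that n ne by (auto simp: D_act_gen_def)
        ultimately show False by simp
      qed
      then show "D_cong n w []" using D_cong_last_two[OF n w(1)] by auto
    qed
  next
    case (step k)
    show ?case
    proof (intro allI impI)
      fix w assume w: "set w \<subseteq> {k..n}" "D_act n w = (\<lambda>b. b)"
      have k: "1 \<le> k" "k \<le> n - 2" using step by auto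
      obtain c h where ch: "c \<in> D_cosets n k" "set h \<subseteq> {k + 1..n}" "D_cong n w (c @ h)"
        using D_coset_decomposition[OF n k w(1)] by blast
      have "set w \<subseteq> {1..n}" using w k by auto
      then have act: "D_act n (c @ h) = (\<lambda>b. b)"
        using D_act_cox_cong[OF n ch(3)] w(2) by simp
      have "D_act n h (D_basis k) = D_basis k"
        using n k ch(2) by (intro D_act_basis_fix) auto
      then have "D_act n c (D_basis k) = D_basis k"
        using fun_cong[OF act, of "D_basis k"] by simp
      then have "c = []" using D_coset_trivial[OF n k(2) ch(1)] by simp
      then have "D_cong n w h" "D_act n h = (\<lambda>b. b)" using ch(3) act by auto
      moreover have "D_cong n h []" using step.IH ch(2) calculation(2) by auto
      ultimately show "D_cong n w []" by (blast intro: cox_cong.trans)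
    qed
  qed
  from this[of 1] show ?thesis using assms by auto
qed

lemma D_act_outside:
  "n \<ge> 4 \<Longrightarrow> set u \<subseteq> {1..n} \<Longrightarrow> i \<notin> {1..n} \<Longrightarrow> D_act n u b i = b i"
proof (induction u)
  case (Cons s u)
  then have "D_act_gen n s (D_act n u b) i = D_act n u b i"
    by (auto simp: D_act_gen_def)
  then show ?case using Cons by auto
qed auto

lemma D_act_rev_cancel:
  assumes "n \<ge> 4" "set u \<subseteq> {1..n}"
  shows "D_act n (rev u) (D_act n u b) = b"
proof -
  have "D_act n (rev u @ u) = D_act n []"
    using assms by (intro D_act_cox_cong cox_cong_rev_cancel) auto
  then show ?thesis by (metis D_act_simps(1,3))
qed

lemma D_act_faithful:
  assumes n: "n \<ge> 4" and u: "set u \<subseteq> {1..n}" and v: "set v \<subseteq> {1..n}"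
    and eq: "\<And>b i. i \<in> {1..n} \<Longrightarrow> D_act n u b i = D_act n v b i"
  shows "D_cong n u v"
proof -
  have "D_act n u b = D_act n v b" for b
    using eq D_act_outside[OF n u] D_act_outside[OF n v] by (intro ext) metis
  then have "D_act n (rev v @ u) = (\<lambda>b. b)"
    using D_act_rev_cancel[OF n v] by (intro ext) simp
  then have "D_cong n (rev v @ u) []"
    using n u v by (intro D_act_trivial) auto
  from cox_cong_append_left[OF this, of v] have "D_cong n (v @ rev v @ u) v" by simp
  moreover have "D_cong n (v @ rev v @ u) u"
    using cox_cong_append_right[OF cox_cong_rev_cancel[of "rev v" "{1..n}" "D_edges n"], of u] v by simp
  ultimately show ?thesis by (blast intro: cox_cong.sym cox_cong.trans)
qed

section \<open>Scalar elements: centrality, parity of signs, and the element -1\<close>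

definition D_scalar :: "nat \<Rightarrow> nat list \<Rightarrow> int \<Rightarrow> bool"
  where "D_scalar n u a \<longleftrightarrow> (\<forall>b. \<forall>i\<in>{1..n}. D_act n u b i = a * b i)"

text \<open>Words act as the identity outside \<open>{1..n}\<close>, so a scalar word multiplies by
  \<open>a\<close> only inside that range. Homogeneity is therefore needed with an assumption
  restricted to these coordinates.\<close>

lemma D_act_scale:
  assumes n: "n \<ge> 4" and u: "set u \<subseteq> {1..n}" and b: "\<And>i. i \<in> {1..n} \<Longrightarrow> b i = a * c i"
    and i: "i \<in> {1..n}"
  shows "D_act n u b i = a * D_act n u c i"
proof -
  obtain \<sigma> \<epsilon> where *: "\<forall>i\<in>{1..n}. \<sigma> i \<in> {1..n} \<and> (\<epsilon> i = 1 \<or> \<epsilon> i = - 1) \<and> (\<forall>b. D_act n u b i = \<epsilon> i * b (\<sigma> i))"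
    using D_act_signed_perm[OF n u] by blast
  then have "\<sigma> i \<in> {1..n}" "D_act n u b i = \<epsilon> i * b (\<sigma> i)" "D_act n u c i = \<epsilon> i * c (\<sigma> i)"
    using i by auto
  then show ?thesis using b by simp
qed

lemma D_scalar_commute:
  assumes n: "n \<ge> 4" and u: "set u \<subseteq> {1..n}" and v: "set v \<subseteq> {1..n}" and a: "D_scalar n u a"
  shows "D_cong n (u @ v) (v @ u)"
proof (rule D_act_faithful[OF n])
  fix b i assume i: "i \<in> {1..n}"
  have "D_act n v (D_act n u b) i = a * D_act n v b i"
    using a i by (intro D_act_scale[OF n v]) (auto simp: D_scalar_def)
  then show "D_act n (u @ v) b i = D_act n (v @ u) b i"
    using a i by (simp add: D_scalar_def)
qed (use u v in auto)

text \<open>The generators from 2 on fix \<open>e_1\<close>, hence by centrality also its image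
  \<open>v\<close>. The path generators make \<open>v\<close> constant on the coordinates from 2 on,
  and the generator \<open>n\<close> makes that constant its own negative, so
  \<open>v = a e_1\<close>. The path generators then carry this eigenvalue to every basis
  vector.\<close>

lemma D_central_scalar:
  assumes n: "n \<ge> 4" and w: "set w \<subseteq> {1..n}"
    and central: "\<And>s b. s \<in> {1..n} \<Longrightarrow> D_act n w (D_act_gen n s b) = D_act_gen n s (D_act n w b)"
  shows "\<exists>a. (a = 1 \<or> a = - 1) \<and> D_scalar n w a"
proof -
  obtain \<sigma> \<epsilon> where *: "\<forall>i\<in>{1..n}. \<sigma> i \<in> {1..n} \<and> (\<epsilon> i = 1 \<or> \<epsilon> i = - 1) \<and> (\<forall>b. D_act n w b i = \<epsilon> i * b (\<sigma> i))"
    using D_act_signed_perm[OF n w] by blast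
  define v where "v = D_act n w (D_basis 1)"
  have stab: "D_act_gen n s v = v" if "2 \<le> s" "s \<le> n" for s
  proof -
    have "D_act n [s] (D_basis 1) = D_basis 1" using n that by (intro D_act_basis_fix) auto
    then show ?thesis using central[of s "D_basis 1"] that by (simp add: v_def)
  qed
  have eq: "v (s + 1) = v s" if "2 \<le> s" "s < n" for s
    using fun_cong[OF stab[of s], of s] that by (simp add: D_act_gen_less)
  have "v n = - v (n - 1)"
    using fun_cong[OF stab[of n], of n] n by (simp add: D_act_gen_last)
  moreover have "v n = v (n - 1)" using eq[of "n - 1"] n by simp
  ultimately have "v n = 0" by simp
  have zero: "v i = 0" if "i \<le> n" "2 \<le> i" for i
    using that
  proof (induction i rule: inc_induct)
    case base
    show ?case by (rule \<open>v n = 0\<close>)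
  next
    case (step i)
    then show ?case using eq[of i] by simp
  qed
  define a where "a = v 1"
  have diag: "\<forall>i\<in>{1..n}. D_act n w (D_basis j) i = a * D_basis j i" if "1 \<le> j" "j \<le> n" for j
    using that
  proof (induction j rule: dec_induct)
    case base
    have "v i = a * D_basis 1 i" if "i \<in> {1..n}" for i
      using zero[of i] that by (cases "i = 1") (auto simp: a_def)
    then show ?case unfolding v_def by blast
  next
    case (step j)
    have "D_basis (Suc j) = D_act_gen n j (D_basis j)"
      using step by (auto simp: D_act_gen_def fun_eq_iff)
    then have 1: "D_act n w (D_basis (Suc j)) = D_act_gen n j (D_act n w (D_basis j))"
      using central[of j] step by simp
    show ?case
      unfolding 1 using step by (auto simp: D_act_gen_less)
  qed
  \<comment> \<open>The test vector is the basis vector at \<open>\<sigma> i\<close>: its image has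
    the nonzero entry \<open>\<epsilon> i\<close> at \<open>i\<close>, whereas the diagonal form
    allows a nonzero entry there only if \<open>\<sigma> i = i\<close>.\<close>
  have \<epsilon>: "\<epsilon> i = a \<and> \<sigma> i = i" if "i \<in> {1..n}" for i
  proof -
    have "\<sigma> i \<in> {1..n}" "\<epsilon> i = 1 \<or> \<epsilon> i = - 1" "D_act n w (D_basis (\<sigma> i)) i = \<epsilon> i"
      using * that by auto
    moreover have "D_act n w (D_basis (\<sigma> i)) i = a * D_basis (\<sigma> i) i"
      using diag[of "\<sigma> i"] calculation(1) that by auto
    ultimately show ?thesis by (auto simp: of_bool_def split: if_splits)
  qed
  have "a = 1 \<or> a = - 1" using \<epsilon>[of 1] * n by auto
  moreover have "D_scalar n w a"
    using \<epsilon> * by (auto simp: D_scalar_def)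
  ultimately show ?thesis by blast
qed

text \<open>An even number of signs is changed: the product of the coordinates is invariant.\<close>

lemma D_act_prod:
  assumes n: "n \<ge> 4"
  shows "set u \<subseteq> {1..n} \<Longrightarrow> (\<Prod>i\<in>{1..n}. D_act n u b i) = (\<Prod>i\<in>{1..n}. b i)"
proof (induction u)
  case (Cons s u)
  have "(\<Prod>i\<in>{1..n}. D_act_gen n s c i) = (\<Prod>i\<in>{1..n}. c i)" for c
  proof -
    \<comment> \<open>The generator affects exactly the coordinates \<open>p\<close> and
      \<open>p + 1\<close>: it swaps them, and for \<open>s = n\<close> the two signs cancel in the
      product.\<close>
    define p where "p = (if s < n then s else n - 1)"
    have p: "p \<in> {1..n}" "p + 1 \<in> {1..n}" using Cons.prems n by (auto simp: p_def)
    have split: "(\<Prod>i\<in>{1..n}. f i) = f p * f (p + 1) * (\<Prod>i\<in>{1..n} - {p, p + 1}. f i)" for f :: "nat \<Rightarrow> int"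
      using p prod.subset_diff[of "{p, p + 1}" "{1..n}" f] by (simp add: mult.commute)
    have "D_act_gen n s c p * D_act_gen n s c (p + 1) = c p * c (p + 1)"
      using Cons.prems n by (auto simp: D_act_gen_def p_def)
    moreover have "(\<Prod>i\<in>{1..n} - {p, p + 1}. D_act_gen n s c i) = (\<Prod>i\<in>{1..n} - {p, p + 1}. c i)"
      using Cons.prems n
      by (cases "s < n"; intro prod.cong) (auto simp: D_act_gen_def p_def)
    ultimately show ?thesis by (simp only: split)
  qed
  then show ?case using Cons by simp
qed simp

lemma D_scalar_odd:
  assumes "n \<ge> 4" "set u \<subseteq> {1..n}" "D_scalar n u a" "a = 1 \<or> a = - 1" "odd n"
  shows "a = 1"
proof -
  have "(\<Prod>i\<in>{1..n}. D_act n u (\<lambda>_. 1) i) = (\<Prod>i\<in>{1..n}. a)"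
    using assms(3) by (intro prod.cong) (auto simp: D_scalar_def)
  then have "a ^ n = 1" using D_act_prod[OF assms(1,2), of "\<lambda>_. 1"] by simp
  then show ?thesis using assms(4,5) by auto
qed

text \<open>The product of the two leaf generators changes the last two signs; its conjugates change
  the signs of the \<open>i\<close>-th and the last coordinate.\<close>

lemma D_two_signs:
  assumes n: "n \<ge> 4" and i: "1 \<le> i" "i < n"
  shows "\<exists>u. set u \<subseteq> {1..n} \<and> (\<forall>b. D_act n u b = b(i := - b i, n := - b n))"
proof -
  have "i \<le> n - 1" using i by simp
  then show ?thesis
  proof (induction i rule: inc_induct)
    case base
    have "D_act n [n - 1, n] b = b(n - 1 := - b (n - 1), n := - b n)" for b
      using n by (auto simp: D_act_gen_def fun_eq_iff)
    then show ?case using n by (intro exI[of _ "[n - 1, n]"]) auto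
  next
    case (step j)
    then obtain u where u: "set u \<subseteq> {1..n}" "\<And>b. D_act n u b = b(Suc j := - b (Suc j), n := - b n)"
      by blast
    have "D_act n (j # u @ [j]) b = b(j := - b j, n := - b n)" for b
      using step.hyps by (auto simp: u D_act_gen_def fun_eq_iff)
    then show ?case using u step.hyps i by (intro exI[of _ "j # u @ [j]"]) auto
  qed
qed

text \<open>The coordinates \<open>1, ..., n - 1\<close> are negated one at a time, each together
  with coordinate \<open>n\<close>. The last coordinate thus collects \<open>n - 1\<close> signs, an
  odd number when \<open>n\<close> is even.\<close>

lemma D_minus_one_exists:
  assumes n: "n \<ge> 4" and "even n"
  shows "\<exists>u. set u \<subseteq> {1..n} \<and> D_scalar n u (- 1)"
proof -
  have "\<exists>u. set u \<subseteq> {1..n} \<and> (\<forall>b. \<forall>i\<in>{1..n}. D_act n u b i =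
      (if i \<le> m then - b i else if i = n then (- 1) ^ m * b i else b i))" if "m < n" for m
    using that
  proof (induction m)
    case 0
    show ?case by (intro exI[of _ "[]"]) auto
  next
    case (Suc m)
    then obtain u where u: "set u \<subseteq> {1..n}" "\<forall>b. \<forall>i\<in>{1..n}. D_act n u b i =
      (if i \<le> m then - b i else if i = n then (- 1) ^ m * b i else b i)" by auto
    obtain v where v: "set v \<subseteq> {1..n}" "\<forall>b. D_act n v b = b(Suc m := - b (Suc m), n := - b n)"
      using D_two_signs[OF n, of "Suc m"] Suc.prems by auto
    have "D_act n (u @ v) b i =
        (if i \<le> Suc m then - b i else if i = n then (- 1) ^ Suc m * b i else b i)"
      if "i \<in> {1..n}" for b i
      using that u(2) v(2) Suc.prems by (auto simp: le_Suc_eq)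
    then show ?case using u(1) v(1) by (intro exI[of _ "u @ v"]) auto
  qed
  from this[of "n - 1"] n obtain u where u: "set u \<subseteq> {1..n}" "\<forall>b. \<forall>i\<in>{1..n}. D_act n u b i =
      (if i \<le> n - 1 then - b i else if i = n then (- 1) ^ (n - 1) * b i else b i)" by auto
  have "odd (n - 1)" using assms by simp
  then have "(- 1 :: int) ^ (n - 1) = - 1" by simp
  then have "D_scalar n u (- 1)" using u(2) by (auto simp: D_scalar_def)
  then show ?thesis using u(1) by blast
qed

section \<open>The Vogan representation as the weight lattice modulo 2\<close>

text \<open>The pairing of the weight \<open>b / 2\<close> with the \<open>i\<close>-th simple coroot. The weight lattice of type D
  consists of the vectors \<open>b / 2\<close> for which all coordinates of the integer vector \<open>b\<close> have the same
  parity, and then the division is exact.\<close>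

definition D_coord :: "nat \<Rightarrow> (nat \<Rightarrow> int) \<Rightarrow> nat \<Rightarrow> int"
  where "D_coord n b i = (if i < n then b i - b (i + 1) else b (n - 1) + b n) div 2"

definition D_lattice :: "nat \<Rightarrow> (nat \<Rightarrow> int) \<Rightarrow> bool"
  where "D_lattice n b \<longleftrightarrow> (\<forall>i\<in>{1..n}. \<forall>j\<in>{1..n}. even (b i) \<longleftrightarrow> even (b j))"

definition D_weight :: "nat \<Rightarrow> (nat \<Rightarrow> int) \<Rightarrow> bit vec"
  where "D_weight n b = vec n (\<lambda>u. of_int (D_coord n b (Suc u)))"

lemma D_weight_carrier [simp]: "D_weight n b \<in> carrier_vec n"
  by (simp add: D_weight_def)

lemma D_latticeD:
  "D_lattice n b \<Longrightarrow> i \<in> {1..n} \<Longrightarrow> j \<in> {1..n} \<Longrightarrow> even (b i) \<longleftrightarrow> even (b j)"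
  unfolding D_lattice_def by blast

lemma D_coord_double:
  assumes "n \<ge> 4" "D_lattice n b" "i \<in> {1..n}"
  shows "2 * D_coord n b i = (if i < n then b i - b (i + 1) else b (n - 1) + b n)"
proof -
  have "even (b i - b (i + 1))" if "i < n"
    using D_latticeD[OF assms(2,3), of "i + 1"] that by simp
  moreover have "even (b (n - 1) + b n)"
    using D_latticeD[OF assms(2), of "n - 1" n] assms(1) by simp
  ultimately show ?thesis by (simp add: D_coord_def)
qed

lemma D_lattice_act:
  assumes n: "n \<ge> 4" and u: "set u \<subseteq> {1..n}" and b: "D_lattice n b"
  shows "D_lattice n (D_act n u b)"
proof -
  obtain \<sigma> \<epsilon> where *: "\<forall>i\<in>{1..n}. \<sigma> i \<in> {1..n} \<and> (\<epsilon> i = 1 \<or> \<epsilon> i = - 1) \<and> (\<forall>b. D_act n u b i = \<epsilon> i * b (\<sigma> i))"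
    using D_act_signed_perm[OF n u] by blast
  have parity: "even (D_act n u b i) \<longleftrightarrow> even (b (\<sigma> i))" "\<sigma> i \<in> {1..n}" if "i \<in> {1..n}" for i
  proof -
    have "\<epsilon> i = 1 \<or> \<epsilon> i = - 1" "D_act n u b i = \<epsilon> i * b (\<sigma> i)" using * that by blast+
    then show "even (D_act n u b i) \<longleftrightarrow> even (b (\<sigma> i))" by auto
    show "\<sigma> i \<in> {1..n}" using * that by blast
  qed
  show ?thesis
    unfolding D_lattice_def
  proof (intro ballI)
    fix i j assume "i \<in> {1..n}" "j \<in> {1..n}"
    then show "even (D_act n u b i) \<longleftrightarrow> even (D_act n u b j)"
      using parity[of i] parity[of j] D_latticeD[OF b, of "\<sigma> i" "\<sigma> j"] by blast
  qed
qed

text \<open>The reflection in the simple root \<open>s\<close>, whose coordinates are given by the Cartan matrix.\<close>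

lemma D_coord_act_gen:
  assumes n: "n \<ge> 4" and s: "s \<in> {1..n}" and i: "i \<in> {1..n}" and b: "D_lattice n b"
  shows "D_coord n (D_act_gen n s b) i =
    D_coord n b i + (of_bool ({i, s} \<in> D_edges n) - 2 * of_bool (i = s)) * D_coord n b s"
proof -
  have act: "D_lattice n (D_act_gen n s b)"
    using D_lattice_act[OF n, of "[s]" b] s b by simp
  have edge: "{i, s} \<in> D_edges n \<longleftrightarrow>
    (s = i + 1 \<and> s < n) \<or> (i = s + 1 \<and> i < n) \<or> (i + 2 = n \<and> s = n) \<or> (s + 2 = n \<and> i = n)"
    unfolding D_edges_iff[OF n] using n s i by auto
  define k where "k = n - 1"
  have k: "n = Suc k" "k \<ge> 3" using n by (auto simp: k_def)
  \<comment> \<open>Doubling clears the division, so the claim becomes a linear identity in the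
    entries of \<open>b\<close>, checked by the position of \<open>i\<close> relative to
    \<open>s\<close>.\<close>
  have "2 * D_coord n (D_act_gen n s b) i =
    2 * D_coord n b i + (of_bool ({i, s} \<in> D_edges n) - 2 * of_bool (i = s)) * (2 * D_coord n b s)"
    unfolding D_coord_double[OF n act i] D_coord_double[OF n b i] D_coord_double[OF n b s] edge
  proof (cases "s = n")
    case True
    consider "i + 2 < n" | "i + 2 = n" | "i + 1 = n" | "i = n"
      using i unfolding atLeastAtMost_iff by linarith
    then show "(if i < n then D_act_gen n s b i - D_act_gen n s b (i + 1)
        else D_act_gen n s b (n - 1) + D_act_gen n s b n) =
      (if i < n then b i - b (i + 1) else b (n - 1) + b n) +
      (of_bool (s = i + 1 \<and> s < n \<or> i = s + 1 \<and> i < n \<or> i + 2 = n \<and> s = n \<or> s + 2 = n \<and> i = n) -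
       2 * of_bool (i = s)) * (if s < n then b s - b (s + 1) else b (n - 1) + b n)"
      using True k i n by cases (auto simp: D_act_gen_last)
  next
    case False
    then have "s < n" using s by simp
    consider "i = s" | "i = s + 1" "i < n" | "i + 1 = s" | "i \<noteq> s" "i \<noteq> s + 1" "i + 1 \<noteq> s" "i < n"
      | "i = n" "s + 1 = n" | "i = n" "s + 2 = n" | "i = n" "s + 2 < n"
    proof (cases "i < n")
      case True
      have "i = s \<or> i = s + 1 \<or> i + 1 = s \<or> (i \<noteq> s \<and> i \<noteq> s + 1 \<and> i + 1 \<noteq> s)" by blast
      then show ?thesis using that True by blast
    next
      case False
      then have "i = n" using i by simp
      moreover have "s + 1 = n \<or> s + 2 = n \<or> s + 2 < n" using \<open>s < n\<close> by linarith
      ultimately show ?thesis using that by blast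
    qed
    then show "(if i < n then D_act_gen n s b i - D_act_gen n s b (i + 1)
        else D_act_gen n s b (n - 1) + D_act_gen n s b n) =
      (if i < n then b i - b (i + 1) else b (n - 1) + b n) +
      (of_bool (s = i + 1 \<and> s < n \<or> i = s + 1 \<and> i < n \<or> i + 2 = n \<and> s = n \<or> s + 2 = n \<and> i = n) -
       2 * of_bool (i = s)) * (if s < n then b s - b (s + 1) else b (n - 1) + b n)"
      using \<open>s < n\<close> k i by cases (auto simp: D_act_gen_less)
  qed
  then show ?thesis by (simp add: algebra_simps)
qed

lemma vogan_matrix_weight:
  assumes n: "n \<ge> 4" and s: "s \<in> {1..n}" and b: "D_lattice n b"
  shows "vogan_matrix n (D_edges n) s *\<^sub>v D_weight n b = D_weight n (D_act_gen n s b)"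
proof (rule eq_vecI)
  fix u assume "u < dim_vec (D_weight n (D_act_gen n s b))"
  then have u: "u < n" by (simp add: D_weight_def)
  \<comment> \<open>The term \<open>2 * m\<close> collects the diagonal Cartan entry; it disappears
    modulo 2, which leaves only the adjacency part of the Vogan matrix.\<close>
  obtain m where m: "D_coord n (D_act_gen n s b) (Suc u) =
      D_coord n b (Suc u) + of_bool ({Suc u, s} \<in> D_edges n) * D_coord n b s + 2 * m"
    using D_coord_act_gen[OF n s _ b, of "Suc u"] u
    by (intro that[of "- of_bool (Suc u = s) * D_coord n b s"]) (simp add: algebra_simps)
  have "(of_int (D_coord n (D_act_gen n s b) (Suc u)) :: bit) =
      of_int (D_coord n b (Suc u)) + of_bool ({Suc u, s} \<in> D_edges n) * of_int (D_coord n b s)"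
    by (simp only: m of_int_add of_int_mult of_int_of_bool of_int_numeral bit_numeral_even
        mult_zero_left add_0_right)
  then show "(vogan_matrix n (D_edges n) s *\<^sub>v D_weight n b) $ u = D_weight n (D_act_gen n s b) $ u"
    using u s by (subst vogan_matrix_mult_vec) (auto simp: D_weight_def)
qed (simp add: D_weight_def carrier_matD[OF vogan_matrix_carrier])

lemma D_weight_surj:
  assumes n: "n \<ge> 4" and x: "x \<in> carrier_vec n"
  shows "\<exists>b. D_lattice n b \<and> D_weight n b = x"
proof -
  define t :: "nat \<Rightarrow> int" where "t j = of_bool (x $ (j - 1) = 1)" for j
  \<comment> \<open>This solves \<open>b i - b (i + 1) = 2 * t i\<close> for \<open>i < n\<close>
    and \<open>b (n - 1) + b n = 2 * t n\<close>: the last two equations give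
    \<open>b n = t n - t (n - 1)\<close>, and the others telescope.\<close>
  define b where "b i = t n - t (n - 1) + 2 * (\<Sum>j\<in>{i..<n}. t j)" for i
  have "even (b i) \<longleftrightarrow> even (t n - t (n - 1))" for i
    by (simp add: b_def)
  then have lat: "D_lattice n b" by (simp add: D_lattice_def)
  have "D_coord n b i = t i" if "i \<in> {1..n}" for i
  proof (cases "i < n")
    case True
    then show ?thesis by (simp add: D_coord_def b_def sum.atLeast_Suc_lessThan)
  next
    case False
    then have "i = n" using that by simp
    moreover have "{n - 1..<n} = {n - 1}" using n by auto
    ultimately show ?thesis by (simp add: D_coord_def b_def)
  qed
  then have "D_weight n b = x"
    using x by (intro eq_vecI) (auto simp: D_weight_def t_def)
  then show ?thesis using lat by blast
qed

lemma D_weight_eq_iff: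
  "D_weight n b = D_weight n c \<longleftrightarrow> (\<forall>i\<in>{1..n}. even (D_coord n b i - D_coord n c i))"
proof -
  have bit: "(of_int p :: bit) = of_int q \<longleftrightarrow> even (p - q)" for p q
    unfolding Z2.bit_eq_iff even_of_int_iff by simp
  have "D_weight n b = D_weight n c \<longleftrightarrow> (\<forall>u<n. (of_int (D_coord n b (Suc u)) :: bit) = of_int (D_coord n c (Suc u)))"
    by (simp only: D_weight_def vec_eq_iff dim_vec index_vec simp_thms cong: imp_cong)
  also have "\<dots> \<longleftrightarrow> (\<forall>i\<in>Suc ` {..<n}. even (D_coord n b i - D_coord n c i))"
    unfolding bit by blast
  finally show ?thesis by (simp add: image_Suc_lessThan)
qed

text \<open>The halved difference is twice a weight, so \<open>b - c\<close> is 4 times a weight,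
  whose entries are either all integers or all half-integers.\<close>

lemma D_weight_eq_mod_4:
  assumes n: "n \<ge> 4" and b: "D_lattice n b" and c: "D_lattice n c"
    and eq: "D_weight n b = D_weight n c" and i: "i \<in> {1..n}"
  shows "even (b i - c i)" "4 dvd (b i - c i) - (b n - c n)"
proof -
  define d where "d i = b i - c i" for i
  have co: "4 dvd (2 * D_coord n b i - 2 * D_coord n c i)" if "i \<in> {1..n}" for i
  proof -
    have "even (D_coord n b i - D_coord n c i)" using eq that unfolding D_weight_eq_iff by blast
    then obtain k where "D_coord n b i - D_coord n c i = 2 * k" by (rule evenE)
    then have "2 * D_coord n b i - 2 * D_coord n c i = 4 * k" by linarith
    then show ?thesis by (rule dvdI)
  qed
  have step: "4 dvd d i - d (i + 1)" if "i \<in> {1..n}" "i < n" for i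
  proof -
    have "d i - d (i + 1) = 2 * D_coord n b i - 2 * D_coord n c i"
      using that by (simp add: D_coord_double[OF n b] D_coord_double[OF n c] d_def)
    then show ?thesis using co that by metis
  qed
  have const: "4 dvd d i - d n" if "i \<le> n" "1 \<le> i" for i
    using that
  proof (induction i rule: inc_induct)
    case (step j)
    then have "4 dvd (d j - d (j + 1)) + (d (Suc j) - d n)"
      using \<open>\<And>i. i \<in> {1..n} \<Longrightarrow> i < n \<Longrightarrow> 4 dvd d i - d (i + 1)\<close>[of j] by (intro dvd_add) auto
    then show ?case by simp
  qed simp
  have "d (n - 1) + d n = 2 * D_coord n b n - 2 * D_coord n c n"
    using n by (simp add: D_coord_double[OF n b] D_coord_double[OF n c] d_def)
  then have "4 dvd d (n - 1) + d n" using co[of n] n by auto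
  moreover have "4 dvd d (n - 1) - d n" using const[of "n - 1"] n by simp
  \<comment> \<open>Subtracting the two congruences at the fork gives \<open>4 dvd 2 * d n\<close>,
    which is where evenness of the entries comes from.\<close>
  ultimately have "4 dvd (d (n - 1) + d n) - (d (n - 1) - d n)" by (rule dvd_diff)
  then have "even (d n)" by presburger
  moreover have "4 dvd d i - d n" using const i by simp
  ultimately show "even (b i - c i)" "4 dvd (b i - c i) - (b n - c n)"
    unfolding d_def by presburger+
qed

lemma D_weight_scalar:
  assumes n: "n \<ge> 4" and b: "D_lattice n b" and a: "a = 1 \<or> a = - 1"
    and c: "\<And>i. i \<in> {1..n} \<Longrightarrow> c i = a * b i"
  shows "D_weight n c = D_weight n b"
proof -
  have lat: "D_lattice n c"
    unfolding D_lattice_def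
  proof (intro ballI)
    fix i j assume "i \<in> {1..n}" "j \<in> {1..n}"
    then show "even (c i) \<longleftrightarrow> even (c j)"
      using a c[of i] c[of j] D_latticeD[OF b, of i j] by (elim disjE) simp_all
  qed
  have "even (D_coord n c i - D_coord n b i)" if i: "i \<in> {1..n}" for i
  proof -
    have "2 * D_coord n c i = a * (2 * D_coord n b i)"
      unfolding D_coord_double[OF n b i] D_coord_double[OF n lat i]
      using n i c by (auto simp: algebra_simps)
    then have "D_coord n c i = a * D_coord n b i" by simp
    then show ?thesis using a by auto
  qed
  then show ?thesis unfolding D_weight_eq_iff by blast
qed

lemma D_scalar_of_trivial_weights:
  assumes n: "n \<ge> 4" and u: "set u \<subseteq> {1..n}"
    and triv: "\<And>b. D_lattice n b \<Longrightarrow> D_weight n (D_act n u b) = D_weight n b"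
  shows "\<exists>a. (a = 1 \<or> a = - 1) \<and> D_scalar n u a"
proof -
  obtain \<sigma> \<epsilon> where *: "\<forall>i\<in>{1..n}. \<sigma> i \<in> {1..n} \<and> (\<epsilon> i = 1 \<or> \<epsilon> i = - 1) \<and> (\<forall>b. D_act n u b i = \<epsilon> i * b (\<sigma> i))"
    using D_act_signed_perm[OF n u] by blast
  have sg: "\<sigma> i \<in> {1..n}" "\<epsilon> i = 1 \<or> \<epsilon> i = - 1" "D_act n u b i = \<epsilon> i * b (\<sigma> i)"
    if "i \<in> {1..n}" for i b
  proof -
    note h = bspec[OF * that]
    show "\<sigma> i \<in> {1..n}" by (rule conjunct1[OF h])
    show "\<epsilon> i = 1 \<or> \<epsilon> i = - 1" by (rule conjunct1[OF conjunct2[OF h]])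
    show "D_act n u b i = \<epsilon> i * b (\<sigma> i)" by (rule spec[OF conjunct2[OF conjunct2[OF h]]])
  qed
  have diff: "4 dvd (\<epsilon> i * b (\<sigma> i) - b i) - (\<epsilon> j * b (\<sigma> j) - b j)"
    if b: "D_lattice n b" and "i \<in> {1..n}" "j \<in> {1..n}" for b i j
  proof -
    note mod4 = D_weight_eq_mod_4(2)[OF n D_lattice_act[OF n u b] b triv[OF b]]
    have "4 dvd (D_act n u b i - b i) - (D_act n u b j - b j)"
      using dvd_diff[OF mod4[OF that(2)] mod4[OF that(3)]]
      by (simp add: algebra_simps)
    then show ?thesis by (simp only: sg(3)[OF that(2)] sg(3)[OF that(3)])
  qed
  \<comment> \<open>The test vector is \<open>2 e_i\<close>. If
    \<open>\<sigma> i \<noteq> i\<close>, entry \<open>i\<close> changes by -2, so every other entry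
    must also change by 2 modulo 4, and entry \<open>m\<close> can do so only by reading position
    \<open>i\<close>.\<close>
  have other: "\<sigma> m = i" if i: "i \<in> {1..n}" "\<sigma> i \<noteq> i" and m: "m \<in> {1..n}" "m \<noteq> i" for i m
  proof (rule ccontr)
    assume "\<sigma> m \<noteq> i"
    have "D_lattice n (\<lambda>j. 2 * D_basis i j)" by (simp add: D_lattice_def)
    from diff[OF this m(1) i(1)] show False using i m \<open>\<sigma> m \<noteq> i\<close> by simp
  qed
  have perm: "\<sigma> i = i" if i: "i \<in> {1..n}" for i
  proof (rule ccontr)
    assume ne: "\<sigma> i \<noteq> i"
    \<comment> \<open>With a third index \<open>l\<close> the previous claim applies both to
      \<open>i\<close> and to \<open>m\<close>, and demands that \<open>\<sigma> l\<close> be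
      \<open>i\<close> and \<open>m\<close> at once.\<close>
    obtain m l where m: "m \<in> {1..n}" "m \<noteq> i" and l: "l \<in> {1..n}" "l \<noteq> i" "l \<noteq> m"
    proof -
      consider "i = 1" | "i = 2" | "i \<noteq> 1" "i \<noteq> 2" by blast
      then show ?thesis
      proof cases
        case 1
        show ?thesis by (rule that[of 2 3]) (use 1 n in simp_all)
      next
        case 2
        show ?thesis by (rule that[of 1 3]) (use 2 n in simp_all)
      next
        case 3
        show ?thesis by (rule that[of 1 2]) (use 3 n in simp_all)
      qed
    qed
    have "\<sigma> m = i" using other[OF i ne m] .
    then have "\<sigma> m \<noteq> m" using m by simp
    from other[OF m(1) this l(1,3)] have "\<sigma> l = m" .
    moreover have "\<sigma> l = i" using other[OF i ne l(1,2)] .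
    ultimately show False using m by simp
  qed
  have "\<epsilon> i = \<epsilon> 1" if i: "i \<in> {1..n}" for i
  proof -
    \<comment> \<open>The all-ones vector is the doubled spin weight: its entries change by 0 or -2,
      which are incongruent modulo 4, so all signs agree.\<close>
    have "D_lattice n (\<lambda>_. 1)" by (simp add: D_lattice_def)
    then have "4 dvd \<epsilon> i - \<epsilon> 1" using diff[of "\<lambda>_. 1" i 1] i n by simp
    moreover have "\<epsilon> i = 1 \<or> \<epsilon> i = - 1" "\<epsilon> 1 = 1 \<or> \<epsilon> 1 = - 1"
      using sg(2)[OF i] sg(2)[of 1] n by simp_all
    ultimately show ?thesis by (elim disjE) simp_all
  qed
  then have "D_scalar n u (\<epsilon> 1)"
    unfolding D_scalar_def using sg(3) perm by metis
  moreover have "\<epsilon> 1 = 1 \<or> \<epsilon> 1 = - 1" using sg(2)[of 1] n by simp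
  ultimately show ?thesis by blast
qed

section \<open>Kernel and center\<close>

abbreviation D_class :: "nat \<Rightarrow> nat list \<Rightarrow> nat sword set"
  where "D_class n u \<equiv> pres_class (D_vertices n) (coxeter_relators (D_vertices n) (D_edges n)) (pos_word u)"

lemma carrier_D_group: "carrier (D_group n) = D_class n ` {u. set u \<subseteq> {1..n}}"
proof -
  let ?S = "D_vertices n" and ?Q = "coxeter_relators (D_vertices n) (D_edges n)"
  have "\<exists>u. set u \<subseteq> {1..n} \<and> pres_class ?S ?Q w = D_class n u" if w: "w \<in> swords ?S" for w
  proof -
    have e: "pres_eq ?S ?Q w (pos_word (map fst w))" by (rule pres_eq_pos_word[OF w])
    then have m: "pos_word (map fst w) \<in> swords ?S" using pres_eq_swords by blast
    then have "set (map fst w) \<subseteq> {1..n}" by (simp only: pos_word_swords D_vertices_def)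
    moreover have "pres_class ?S ?Q w = D_class n (map fst w)" using pres_class_eq_iff[OF w m] e by blast
    ultimately show ?thesis by blast
  qed
  moreover have "D_class n u \<in> pres_class ?S ?Q ` swords ?S" if "set u \<subseteq> {1..n}" for u
    using that by (intro imageI) (simp add: D_vertices_def)
  ultimately show ?thesis
    unfolding coxeter_group_def carrier_presented_group by blast
qed

lemma D_class_eq_iff:
  assumes n: "n \<ge> 4" and u: "set u \<subseteq> {1..n}" and v: "set v \<subseteq> {1..n}"
  shows "D_class n u = D_class n v \<longleftrightarrow> D_act n u = D_act n v"
proof
  assume "D_class n u = D_class n v"
  then have "pres_eq (D_vertices n) (coxeter_relators (D_vertices n) (D_edges n)) (pos_word u) (pos_word v)"
    using u v by (simp add: pres_class_eq_iff D_vertices_def)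
  from D_act_pres_eq[OF n this] show "D_act n u = D_act n v" by (simp add: comp_def)
next
  assume "D_act n u = D_act n v"
  then have "D_cong n u v" using n u v by (intro D_act_faithful) auto
  from cox_cong_pres_eq[OF this u] show "D_class n u = D_class n v"
    using u v by (simp add: pres_class_eq_iff D_vertices_def)
qed

lemma mult_D_class:
  "set u \<subseteq> {1..n} \<Longrightarrow> set v \<subseteq> {1..n} \<Longrightarrow> D_class n u \<otimes>\<^bsub>D_group n\<^esub> D_class n v = D_class n (u @ v)"
  by (simp add: coxeter_group_def mult_presented_group D_vertices_def)

lemma one_D_group: "\<one>\<^bsub>D_group n\<^esub> = D_class n []"
  by (simp add: coxeter_group_def one_presented_group)

lemma group_D_group: "group (D_group n)"
  by (simp add: coxeter_group_def group_presented_group)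

lemma carrier_GL_F2: "carrier (GL_F2 n) \<subseteq> carrier_mat n n"
  by (auto simp: GL_F2_def units_of_def ring_mat_simps Units_def)

lemma vogan_representation_word:
  assumes n: "n \<ge> 4" and \<phi>: "vogan_representation n \<phi>" and u: "set u \<subseteq> {1..n}"
  shows "\<phi> (D_class n u) \<in> carrier_mat n n"
    and "D_lattice n b \<Longrightarrow> \<phi> (D_class n u) *\<^sub>v D_weight n b = D_weight n (D_act n u b)"
proof -
  interpret GL: group "GL_F2 n" by (rule group_GL_F2)
  let ?f = "vogan_matrix n (D_edges n)"
  have f: "\<forall>s\<in>D_vertices n. ?f s \<in> carrier (GL_F2 n)"
    using vogan_matrix_GL_F2 D_edges_no_loop[OF n] by (auto simp: D_vertices_def)
  have eval: "\<phi> (D_class n u) = eval_word (GL_F2 n) ?f (pos_word u)"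
    using \<phi> u by (intro GL.hom_presented_group_eq f)
      (auto simp: vogan_representation_def coxeter_group_def coxeter_gen_def D_vertices_def)
  have carr: "eval_word (GL_F2 n) ?f (pos_word v) \<in> carrier_mat n n" if "set v \<subseteq> {1..n}" for v
    using GL.eval_word_closed[OF f, of "pos_word v"] that carrier_GL_F2 by (auto simp: D_vertices_def)
  show "\<phi> (D_class n u) \<in> carrier_mat n n" using eval carr[OF u] by simp
  assume b: "D_lattice n b"
  have "eval_word (GL_F2 n) ?f (pos_word u) *\<^sub>v D_weight n b = D_weight n (D_act n u b)"
    using u
  proof (induction u)
    case Nil
    show ?case by (simp add: GL_F2_simps)
  next
    case (Cons s u)
    have su: "s \<in> {1..n}" "set u \<subseteq> {1..n}" using Cons.prems by auto
    then show ?case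
      using Cons.IH carr[OF su(2)] vogan_matrix_weight[OF n su(1) D_lattice_act[OF n su(2) b]]
      by (simp add: GL_F2_simps assoc_mult_mat_vec[OF vogan_matrix_carrier])
  qed
  then show "\<phi> (D_class n u) *\<^sub>v D_weight n b = D_weight n (D_act n u b)" using eval by simp
qed

lemma D_class_in_kernel_iff:
  assumes n: "n \<ge> 4" and \<phi>: "vogan_representation n \<phi>" and u: "set u \<subseteq> {1..n}"
  shows "D_class n u \<in> kernel (D_group n) (GL_F2 n) \<phi> \<longleftrightarrow> (\<exists>a. (a = 1 \<or> a = - 1) \<and> D_scalar n u a)"
proof -
  have "D_class n u \<in> kernel (D_group n) (GL_F2 n) \<phi> \<longleftrightarrow> \<phi> (D_class n u) = 1\<^sub>m n"
    using u by (auto simp: kernel_def carrier_D_group GL_F2_simps)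
  also have "\<dots> \<longleftrightarrow> (\<exists>a. (a = 1 \<or> a = - 1) \<and> D_scalar n u a)"
  proof
    assume one: "\<phi> (D_class n u) = 1\<^sub>m n"
    have "D_weight n (D_act n u b) = D_weight n b" if "D_lattice n b" for b
      using vogan_representation_word(2)[OF n \<phi> u that] one by simp
    then show "\<exists>a. (a = 1 \<or> a = - 1) \<and> D_scalar n u a"
      by (rule D_scalar_of_trivial_weights[OF n u])
  next
    assume "\<exists>a. (a = 1 \<or> a = - 1) \<and> D_scalar n u a"
    then obtain a where a: "a = 1 \<or> a = - 1" "D_scalar n u a" by blast
    show "\<phi> (D_class n u) = 1\<^sub>m n"
    proof (rule bit_mat_eqI)
      fix x :: "bit vec" assume x: "x \<in> carrier_vec n"
      then obtain b where b: "D_lattice n b" "x = D_weight n b" using D_weight_surj[OF n] by blast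
      have "D_weight n (D_act n u b) = D_weight n b"
        using a(2) by (intro D_weight_scalar[OF n b(1) a(1)]) (simp add: D_scalar_def)
      then show "\<phi> (D_class n u) *\<^sub>v x = 1\<^sub>m n *\<^sub>v x"
        using vogan_representation_word(2)[OF n \<phi> u b(1)] b(2) by simp
    qed (use vogan_representation_word(1)[OF n \<phi> u] in auto)
  qed
  finally show ?thesis .
qed

lemma D_class_in_center_iff:
  assumes n: "n \<ge> 4" and u: "set u \<subseteq> {1..n}"
  shows "D_class n u \<in> group_center (D_group n) \<longleftrightarrow> (\<exists>a. (a = 1 \<or> a = - 1) \<and> D_scalar n u a)"
proof
  assume center: "D_class n u \<in> group_center (D_group n)"
  have "D_act n u (D_act_gen n s b) = D_act_gen n s (D_act n u b)" if s: "s \<in> {1..n}" for s b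
  proof -
    have s': "set [s] \<subseteq> {1..n}" using s by simp
    then have "D_class n [s] \<in> carrier (D_group n)" unfolding carrier_D_group by blast
    then have "D_class n u \<otimes>\<^bsub>D_group n\<^esub> D_class n [s] = D_class n [s] \<otimes>\<^bsub>D_group n\<^esub> D_class n u"
      using center unfolding group_center_def by blast
    then have "D_class n (u @ [s]) = D_class n ([s] @ u)"
      by (simp only: mult_D_class[OF u s'] mult_D_class[OF s' u])
    then have "D_act n (u @ [s]) = D_act n ([s] @ u)"
      using D_class_eq_iff[OF n, of "u @ [s]" "[s] @ u"] u s' by simp
    from fun_cong[OF this, of b] show ?thesis by simp
  qed
  then show "\<exists>a. (a = 1 \<or> a = - 1) \<and> D_scalar n u a" by (rule D_central_scalar[OF n u])
next
  assume "\<exists>a. (a = 1 \<or> a = - 1) \<and> D_scalar n u a"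
  then obtain a where a: "D_scalar n u a" by blast
  have "D_class n u \<otimes>\<^bsub>D_group n\<^esub> g = g \<otimes>\<^bsub>D_group n\<^esub> D_class n u" if "g \<in> carrier (D_group n)" for g
  proof -
    obtain v where v: "set v \<subseteq> {1..n}" "g = D_class n v"
      using \<open>g \<in> carrier (D_group n)\<close> unfolding carrier_D_group by blast
    have "D_act n (u @ v) = D_act n (v @ u)"
      using D_scalar_commute[OF n u v(1) a] u v(1) by (intro D_act_cox_cong[OF n]) auto
    then have "D_class n (u @ v) = D_class n (v @ u)"
      using D_class_eq_iff[OF n, of "u @ v" "v @ u"] u v(1) by simp
    then show ?thesis
      unfolding v(2) by (simp only: mult_D_class[OF u v(1)] mult_D_class[OF v(1) u])
  qed
  then show "D_class n u \<in> group_center (D_group n)"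
    using u unfolding group_center_def carrier_D_group by blast
qed

text \<open>By faithfulness there is at most one group element for each scalar; this bounds the
  kernel by two elements.\<close>

lemma D_scalar_determines:
  assumes n: "n \<ge> 4" and u: "set u \<subseteq> {1..n}" and v: "set v \<subseteq> {1..n}"
    and a: "D_scalar n u a" "D_scalar n v a"
  shows "D_class n u = D_class n v"
proof -
  have "D_cong n u v" using a by (intro D_act_faithful[OF n u v]) (simp add: D_scalar_def)
  from D_act_cox_cong[OF n this u] show ?thesis using D_class_eq_iff[OF n u v] by simp
qed

theorem proposition6p10:
  fixes n :: nat and \<phi> :: "nat sword set \<Rightarrow> bit mat"
  assumes "n \<ge> 4" and "vogan_representation n \<phi>"
  shows "(odd n \<longrightarrow> inj_on \<phi> (carrier (D_group n))) \<and>
         (even n \<longrightarrow> card (kernel (D_group n) (GL_F2 n) \<phi>) = 2) \<and>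
         kernel (D_group n) (GL_F2 n) \<phi> = group_center (D_group n)"
proof (intro conjI impI)
  let ?K = "kernel (D_group n) (GL_F2 n) \<phi>"
  note n = assms(1)
  have hom: "group_hom (D_group n) (GL_F2 n) \<phi>"
    using assms(2) group_D_group group_GL_F2
    unfolding group_hom_def group_hom_axioms_def vogan_representation_def by blast
  have rep: "\<exists>u. set u \<subseteq> {1..n} \<and> x = D_class n u" if "x \<in> carrier (D_group n)" for x
    using that unfolding carrier_D_group by blast
  have K: "?K \<subseteq> carrier (D_group n)" unfolding kernel_def by blast
  have Z: "group_center (D_group n) \<subseteq> carrier (D_group n)" unfolding group_center_def by blast
  have "x \<in> ?K \<longleftrightarrow> x \<in> group_center (D_group n)" if x: "x \<in> carrier (D_group n)" for x
  proof -
    obtain u where u: "set u \<subseteq> {1..n}" "x = D_class n u" using rep[OF x] by blast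
    show ?thesis
      unfolding u(2) D_class_in_kernel_iff[OF assms u(1)] D_class_in_center_iff[OF n u(1)] ..
  qed
  then show "?K = group_center (D_group n)" using K Z by blast
  have e: "set [] \<subseteq> {1..n}" by simp
  have nil1: "D_scalar n [] 1" by (simp add: D_scalar_def)
  have nil: "D_class n [] \<in> ?K"
    unfolding D_class_in_kernel_iff[OF assms e] using nil1 by blast
  have K_scalar: "\<exists>u a. set u \<subseteq> {1..n} \<and> x = D_class n u \<and> (a = 1 \<or> a = - 1) \<and> D_scalar n u a"
    if x: "x \<in> ?K" for x
  proof -
    obtain u where u: "set u \<subseteq> {1..n}" "x = D_class n u" using rep x K by blast
    then show ?thesis using x D_class_in_kernel_iff[OF assms u(1)] by blast
  qed
  show "inj_on \<phi> (carrier (D_group n))" if "odd n"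
  proof -
    have "x = D_class n []" if x: "x \<in> ?K" for x
    proof -
      obtain u a where u: "set u \<subseteq> {1..n}" "x = D_class n u" "a = 1 \<or> a = - 1" "D_scalar n u a"
        using K_scalar[OF x] by blast
      then have "a = 1" using D_scalar_odd[OF n u(1,4,3) \<open>odd n\<close>] by simp
      then show ?thesis using D_scalar_determines[OF n u(1) e _ nil1] u(2,4) by blast
    qed
    then have "?K = {\<one>\<^bsub>D_group n\<^esub>}" using nil unfolding one_D_group by blast
    then show ?thesis using group_hom.inj_iff_trivial_ker[OF hom] by blast
  qed
  show "card ?K = 2" if "even n"
  proof -
    obtain z where z: "set z \<subseteq> {1..n}" "D_scalar n z (- 1)"
      using D_minus_one_exists[OF n \<open>even n\<close>] by blast
    have sub: "?K \<subseteq> {D_class n [], D_class n z}"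
    proof
      fix x assume x: "x \<in> ?K"
      obtain u a where u: "set u \<subseteq> {1..n}" "x = D_class n u" "a = 1 \<or> a = - 1" "D_scalar n u a"
        using K_scalar[OF x] by blast
      show "x \<in> {D_class n [], D_class n z}"
        using u(3)
      proof
        assume "a = 1"
        then show ?thesis using D_scalar_determines[OF n u(1) e _ nil1] u(2,4) by blast
      next
        assume "a = - 1"
        then show ?thesis using D_scalar_determines[OF n u(1) z(1) _ z(2)] u(2,4) by blast
      qed
    qed
    have z_K: "D_class n z \<in> ?K" unfolding D_class_in_kernel_iff[OF assms z(1)] using z(2) by blast
    have ne: "D_class n [] \<noteq> D_class n z"
    proof
      assume "D_class n [] = D_class n z"
      then have "D_act n [] = D_act n z" unfolding D_class_eq_iff[OF n e z(1)] .
      \<comment> \<open>The two kernel elements are told apart over the integers, where 1 and -1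
        differ; their Vogan matrices coincide.\<close>
      then have "D_act n z (\<lambda>_. 1) 1 = D_act n [] (\<lambda>_. 1) 1" by (simp only:)
      moreover have "D_act n z (\<lambda>_. 1) 1 = - 1" using z(2) n by (simp add: D_scalar_def)
      ultimately show False by simp
    qed
    have "?K = {D_class n [], D_class n z}" using sub z_K nil by blast
    then show ?thesis using ne by (simp only: card_2_iff) blast
  qed
qed

end
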